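(* Let $n \geq 1$ and let $X \subseteq \mathbb{R}^n$ be $\langle \mathbb{R},+,<,\mathbb{Z}\rangle$-definable. Then $X$ is $\langle \mathbb{R},+,<,1\rangle$-definable if and only if the following two conditions hold: (1) There exist finitely many $X$-singular points. (2) Every rational section of $X$ is $\langle \mathbb{R},+,<,1\rangle$-definable.
   Context: Structures are one-sorted with domain $\mathbb{R}$ and formulas are first-order with equality. In $\langle \mathbb{R},+,<,\mathbb{Z}\rangle$, $\mathbb{Z}$ is a unary predicate satisfied exactly by the integers; in $\langle \mathbb{R},+,<,1\rangle$, $1$ is a constant. A relation $X\subseteq\mathbb{R}^n$ is definable in a structure $\mathcal{M}$ ($\mathcal M$-definable) if there is a formula $\varphi(x_1,\dots,x_n)$ in the signature of $\mathcal{M}$ (no parameters) such that $\varphi(a_1,\dots,a_n)$ holds in $\mathcal M$ iff $(a_1,\dots,a_n)\in X$. $\mathbb{R}^n$ carries the metric given by $|x|=\max_i|x_i|$; $B(x,r)$ is the open ball of center $x$ and radius $r>0$. For $v,y\in\mathbb{R}^n$, $L_v(y)=\{y+\alpha v\mid\alpha\in\mathbb{R}\}$, and for $Y\subseteq\mathbb{R}^n$, $L_v(Y)=\bigcup_{y\in Y}L_v(y)$. A vector $v\in\mathbb{R}^n$ is an $X$-stratum at $x\in\mathbb{R}^n$ if there is a real $r>0$ with $B(x,r)\cap L_v(X\cap B(x,r))\subseteq X$. A point $x\in\mathbb{R}^n$ is $X$-singular if the only $X$-stratum at $x$ is the null vector. A rational section of $X\subseteq\mathbb{R}^n$ is a relation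 of the form $X^{(i)}_c=X\cap(\mathbb{R}^i\times\{c\}\times\mathbb{R}^{n-i-1})$ for some $c\in\mathbb{Q}$ and $0\le i<n$. *)

theory Defs
  imports "HOL-Analysis.Abstract_Euclidean_Space"
begin

text \<open>
  Both structures are reducts of the reals with \<open>+\<close>, \<open><\<close>, the unary predicate for the integers and
  the constant 1, so there is a single syntax and a single satisfaction relation. A formula in
  the signature of a reduct is one all of whose symbols belong to the set \<open>L\<close> of symbols of that
  reduct. Equality is a logical symbol and is always available.
\<close>

datatype sym = PlusS | LessS | IntS | OneS

datatype tm = Var nat | One | Add tm tm

datatype fm =
    Equal tm tm
  | Less tm tm
  | IsInt tm
  | Neg fm
  | Conj fm fm
  | Exists nat fm

primrec tm_syms :: "tm \<Rightarrow> sym set" where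
  "tm_syms (Var k) = {}"
| "tm_syms One = {OneS}"
| "tm_syms (Add s t) = {PlusS} \<union> tm_syms s \<union> tm_syms t"

primrec fm_syms :: "fm \<Rightarrow> sym set" where
  "fm_syms (Equal s t) = tm_syms s \<union> tm_syms t"
| "fm_syms (Less s t) = {LessS} \<union> tm_syms s \<union> tm_syms t"
| "fm_syms (IsInt t) = {IntS} \<union> tm_syms t"
| "fm_syms (Neg p) = fm_syms p"
| "fm_syms (Conj p q) = fm_syms p \<union> fm_syms q"
| "fm_syms (Exists k p) = fm_syms p"

primrec tm_vars :: "tm \<Rightarrow> nat set" where
  "tm_vars (Var k) = {k}"
| "tm_vars One = {}"
| "tm_vars (Add s t) = tm_vars s \<union> tm_vars t"

primrec free_vars :: "fm \<Rightarrow> nat set" where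
  "free_vars (Equal s t) = tm_vars s \<union> tm_vars t"
| "free_vars (Less s t) = tm_vars s \<union> tm_vars t"
| "free_vars (IsInt t) = tm_vars t"
| "free_vars (Neg p) = free_vars p"
| "free_vars (Conj p q) = free_vars p \<union> free_vars q"
| "free_vars (Exists k p) = free_vars p - {k}"

primrec tm_val :: "(nat \<Rightarrow> real) \<Rightarrow> tm \<Rightarrow> real" where
  "tm_val e (Var k) = e k"
| "tm_val e One = 1"
| "tm_val e (Add s t) = tm_val e s + tm_val e t"

primrec sat :: "(nat \<Rightarrow> real) \<Rightarrow> fm \<Rightarrow> bool" where
  "sat e (Equal s t) \<longleftrightarrow> tm_val e s = tm_val e t"
| "sat e (Less s t) \<longleftrightarrow> tm_val e s < tm_val e t"
| "sat e (IsInt t) \<longleftrightarrow> tm_val e t \<in> \<int>"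
| "sat e (Neg p) \<longleftrightarrow> \<not> sat e p"
| "sat e (Conj p q) \<longleftrightarrow> sat e p \<and> sat e q"
| "sat e (Exists k p) \<longleftrightarrow> (\<exists>a. sat (e(k := a)) p)"

text \<open>
  A point of real n-space is a sequence \<open>x :: nat \<Rightarrow> real\<close> with \<open>x i = 0\<close> for all \<open>i \<ge> n\<close>; its
  coordinates are \<open>x 0, \<dots>, x (n - 1)\<close>. Such a sequence serves directly as an assignment of the
  variables \<open>0, \<dots>, n - 1\<close>.
\<close>

abbreviation Rn :: "nat \<Rightarrow> (nat \<Rightarrow> real) set" where
  "Rn n \<equiv> topspace (Euclidean_space n)"

definition definable :: "sym set \<Rightarrow> nat \<Rightarrow> (nat \<Rightarrow> real) set \<Rightarrow> bool" where
  "definable L n X \<longleftrightarrow>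
    (\<exists>p. fm_syms p \<subseteq> L \<and> free_vars p \<subseteq> {..<n} \<and> X = {x \<in> Rn n. sat x p})"

abbreviation RZ_definable :: "nat \<Rightarrow> (nat \<Rightarrow> real) set \<Rightarrow> bool" where
  "RZ_definable \<equiv> definable {PlusS, LessS, IntS}"

abbreviation R1_definable :: "nat \<Rightarrow> (nat \<Rightarrow> real) set \<Rightarrow> bool" where
  "R1_definable \<equiv> definable {PlusS, LessS, OneS}"

text \<open>Only meaningful for \<open>n \<ge> 1\<close>, since the maximum is over the empty set when \<open>n = 0\<close>.\<close>

definition max_norm :: "nat \<Rightarrow> (nat \<Rightarrow> real) \<Rightarrow> real" where
  "max_norm n x = Max ((\<lambda>i. \<bar>x i\<bar>) ` {..<n})"

definition max_ball :: "nat \<Rightarrow> (nat \<Rightarrow> real) \<Rightarrow> real \<Rightarrow> (nat \<Rightarrow> real) set" where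
  "max_ball n x r = {y \<in> Rn n. max_norm n (\<lambda>i. x i - y i) < r}"

definition line_at :: "(nat \<Rightarrow> real) \<Rightarrow> (nat \<Rightarrow> real) \<Rightarrow> (nat \<Rightarrow> real) set" where
  "line_at v y = {(\<lambda>i. y i + \<alpha> * v i) | \<alpha>. True}"

definition lines_through :: "(nat \<Rightarrow> real) \<Rightarrow> (nat \<Rightarrow> real) set \<Rightarrow> (nat \<Rightarrow> real) set" where
  "lines_through v Y = (\<Union>y\<in>Y. line_at v y)"

definition stratum :: "nat \<Rightarrow> (nat \<Rightarrow> real) set \<Rightarrow> (nat \<Rightarrow> real) \<Rightarrow> (nat \<Rightarrow> real) \<Rightarrow> bool" where
  "stratum n X x v \<longleftrightarrow> v \<in> Rn n \<and>
    (\<exists>r>0. max_ball n x r \<inter> lines_through v (X \<inter> max_ball n x r) \<subseteq> X)"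

definition singular :: "nat \<Rightarrow> (nat \<Rightarrow> real) set \<Rightarrow> (nat \<Rightarrow> real) \<Rightarrow> bool" where
  "singular n X x \<longleftrightarrow> x \<in> Rn n \<and> {v. stratum n X x v} = {\<lambda>i. 0}"

definition rational_section :: "nat \<Rightarrow> (nat \<Rightarrow> real) set \<Rightarrow> (nat \<Rightarrow> real) set \<Rightarrow> bool" where
  "rational_section n X Y \<longleftrightarrow> (\<exists>i<n. \<exists>c\<in>\<rat>. Y = X \<inter> {x \<in> Rn n. x i = c})"

end

(*
Let C(x) be the tangent cone of X at x and lin C its lineality space; by linear quantifier
elimination on the integer and fractional parts, X agrees with x + C(x) near x, there are only
finitely many cones C(x), all rational, and lin C(x) is the space of strata at x.

Given finitely many singular points (which are then rational) and definable sections x_j = 0, each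
set T(C) of points with tangent cone C is definable in (R,+,<,1), by induction on lin C. If lin C
is nonzero, it contains a rational v with v_j nonzero. Moving along v, the tangent cone stays C
until it drops to a cone with a strictly smaller lineality space, so T(C) is recovered from those
smaller strata together with its slice x_j = 0. Within the points of that slice at which no smaller
cone occurs and the section of X has the tangent cone of the section of C, the slice of T(C) is
open and closed; hence, by connectedness of segments, it is a union of cells of a definable cell
decomposition.
*)
theory Submission
  imports Defs
begin

section \<open>Rational affine functions and linear quantifier elimination\<close>

text \<open>The obstacle is that cones give only local information: \<open>X\<close> may consist of
  infinitely many cells, one pattern repeated over the integer parts, although only finitely many
  cones occur. Global information comes from the two conditions alone: finiteness settles the cones
  with trivial lineality space, the sections supply the slices for all others.

  Why the cone drops: on leaving a point y in direction v the lineality space can only grow. If the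
  cone just after y is C, then lin of the cone at y lies in lin C; if they are equal, v is a
  lineality direction at y and the cone at y is already C. So a change to C happens only at a
  strictly smaller lineality space.

  Why singular points are rational: the points with given integer parts and with fractional parts in
  a given cell form a convex set on which the cone is constant, and this set has a rational point. A
  singular point with an irrational coordinate would lie on a whole segment of singular points.

  Formulas over +, < and 1 are replaced by closure under equality of the signs of finitely many
  rational affine functions.\<close>

definition move :: "(nat \<Rightarrow> real) \<Rightarrow> real \<Rightarrow> (nat \<Rightarrow> real) \<Rightarrow> nat \<Rightarrow> real" where
  "move x t w = (\<lambda>i. x i + t * w i)"

text \<open>The arguments are whole sequences, not points of \<open>Rn n\<close>: coordinates from
  index n on serve as auxiliary variables that are later quantified and eliminated.\<close>

inductive_set rat_affine :: "((nat \<Rightarrow> real) \<Rightarrow> real) set" where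
  coord: "(\<lambda>x. x k) \<in> rat_affine"
| const: "c \<in> \<rat> \<Longrightarrow> (\<lambda>x. c) \<in> rat_affine"
| add: "f \<in> rat_affine \<Longrightarrow> g \<in> rat_affine \<Longrightarrow> (\<lambda>x. f x + g x) \<in> rat_affine"
| scale: "c \<in> \<rat> \<Longrightarrow> f \<in> rat_affine \<Longrightarrow> (\<lambda>x. c * f x) \<in> rat_affine"

lemma rat_affine_diff:
  assumes "f \<in> rat_affine" "g \<in> rat_affine"
  shows "(\<lambda>x. f x - g x) \<in> rat_affine"
  using rat_affine.add[OF assms(1) rat_affine.scale[OF _ assms(2), of "-1"]] by simp

text \<open>\<open>f w - f (\<lambda>_. 0)\<close> is the linear part of \<open>f\<close> at
  \<open>w\<close>; the lemmas below write it in this form.\<close>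

lemma rat_affine_move: "f \<in> rat_affine \<Longrightarrow> f (move x t w) = f x + t * (f w - f (\<lambda>_. 0))"
proof (induction rule: rat_affine.induct)
  case (add f g)
  show ?case unfolding add.IH by (simp add: algebra_simps)
next
  case (scale c f)
  show ?case unfolding scale.IH by (simp add: algebra_simps)
qed (simp_all add: move_def)

lemma rat_affine_Rats: "f \<in> rat_affine \<Longrightarrow> (\<And>i. x i \<in> \<rat>) \<Longrightarrow> f x \<in> \<rat>"
  by (induction rule: rat_affine.induct) auto

lemma rat_affine_comp:
  assumes "f \<in> rat_affine" and "\<And>k. (\<lambda>x. M x k) \<in> rat_affine"
  shows "(\<lambda>x. f (M x)) \<in> rat_affine"
  using assms(1) by induction (auto intro: rat_affine.intros assms(2))

text \<open>\<open>K\<close> is chosen before \<open>r\<close>, so one constant bounds the linear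
  part both on fractional parts (r = 1) and on arbitrarily short vectors.\<close>

lemma rat_affine_bounded:
  assumes "f \<in> rat_affine"
  shows "\<exists>K\<ge>0. \<forall>r\<ge>0. \<forall>w. (\<forall>i. \<bar>w i\<bar> \<le> r) \<longrightarrow> \<bar>f w - f (\<lambda>_. 0)\<bar> \<le> K * r"
  (is "\<exists>K\<ge>0. ?B f K")
  using assms
proof induction
  case (coord k)
  have "?B (\<lambda>x. x k) 1" by auto
  then show ?case by (meson zero_le_one)
next
  case (const c)
  have "?B (\<lambda>x. c) 0" by auto
  then show ?case by blast
next
  case (add f g)
  obtain K where K: "K \<ge> 0" "?B f K" using add.IH(1) by (elim exE conjE)
  obtain L where L: "L \<ge> 0" "?B g L" using add.IH(2) by (elim exE conjE)
  have "?B (\<lambda>x. f x + g x) (K + L)"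
  proof (intro allI impI)
    fix r :: real and w :: "nat \<Rightarrow> real"
    assume r: "r \<ge> 0" "\<forall>i. \<bar>w i\<bar> \<le> r"
    have "\<bar>f w - f (\<lambda>_. 0)\<bar> \<le> K * r" "\<bar>g w - g (\<lambda>_. 0)\<bar> \<le> L * r"
      using K(2) L(2) r by simp_all
    then show "\<bar>f w + g w - (f (\<lambda>_. 0) + g (\<lambda>_. 0))\<bar> \<le> (K + L) * r"
      by (simp add: algebra_simps)
  qed
  moreover have "K + L \<ge> 0" using K L by simp
  ultimately show ?case by (intro exI[of _ "K + L"] conjI)
next
  case (scale c f)
  obtain K where K: "K \<ge> 0" "?B f K" using scale.IH by (elim exE conjE)
  have "?B (\<lambda>x. c * f x) (\<bar>c\<bar> * K)"
  proof (intro allI impI)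
    fix r :: real and w :: "nat \<Rightarrow> real"
    assume r: "r \<ge> 0" "\<forall>i. \<bar>w i\<bar> \<le> r"
    have "\<bar>f w - f (\<lambda>_. 0)\<bar> \<le> K * r" using K(2) r by simp
    then have "\<bar>c\<bar> * \<bar>f w - f (\<lambda>_. 0)\<bar> \<le> \<bar>c\<bar> * (K * r)" by (intro mult_left_mono) auto
    then show "\<bar>c * f w - c * f (\<lambda>_. 0)\<bar> \<le> \<bar>c\<bar> * K * r"
      by (simp add: abs_mult mult.assoc flip: right_diff_distrib)
  qed
  moreover have "\<bar>c\<bar> * K \<ge> 0" using K by simp
  ultimately show ?case by (intro exI[of _ "\<bar>c\<bar> * K"] conjI)
qed

section \<open>Cells of hyperplane arrangements\<close>

definition agree :: "((nat \<Rightarrow> real) \<Rightarrow> real) set \<Rightarrow> (nat \<Rightarrow> real) \<Rightarrow> (nat \<Rightarrow> real) \<Rightarrow> bool" where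
  "agree A x y \<longleftrightarrow> (\<forall>a\<in>A. sgn (a x) = sgn (a y))"

lemma agree_refl [simp]: "agree A x x"
  by (simp add: agree_def)

lemma agree_sym: "agree A x y \<Longrightarrow> agree A y x"
  by (simp add: agree_def)

lemma agree_trans: "agree A x y \<Longrightarrow> agree A y z \<Longrightarrow> agree A x z"
  by (simp add: agree_def)

lemma agree_Un: "agree (A \<union> B) x y \<longleftrightarrow> agree A x y \<and> agree B x y"
  by (auto simp: agree_def)

lemma agree_insert: "agree (insert a A) x y \<longleftrightarrow> sgn (a x) = sgn (a y) \<and> agree A x y"
  by (auto simp: agree_def)

lemma agree_mono: "agree B x y \<Longrightarrow> A \<subseteq> B \<Longrightarrow> agree A x y"
  by (auto simp: agree_def)

lemma sgn_convex_combination: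
  fixes a b s :: real
  assumes "sgn a = sgn b" "0 \<le> s" "s \<le> 1"
  shows "sgn ((1 - s) * a + s * b) = sgn a"
proof -
  consider "a = 0" | "a > 0" | "a < 0" by linarith
  then show ?thesis
  proof cases
    case 1
    then show ?thesis using assms by (simp add: sgn_zero_iff)
  next
    case 2
    then have "b > 0" using assms by (simp add: sgn_if split: if_splits)
    have "(1 - s) * a + s * b > 0"
      using convex_bound_lt[of "- a" 0 "- b" "1 - s" s] 2 \<open>b > 0\<close> assms by simp
    then show ?thesis using 2 by simp
  next
    case 3
    then have "b < 0" using assms by (simp add: sgn_if split: if_splits)
    have "(1 - s) * a + s * b < 0"
      using convex_bound_lt[of a 0 b "1 - s" s] 3 \<open>b < 0\<close> assms by simp
    then show ?thesis using 3 by simp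
  qed
qed

text \<open>Cells are convex. The segments in the rationality argument for singular points and in
  the treatment of slices come from here.\<close>

lemma agree_segment:
  assumes "A \<subseteq> rat_affine" "agree A x y" "0 \<le> s" "s \<le> 1"
  shows "agree A x (move x s (\<lambda>i. y i - x i))"
  unfolding agree_def
proof
  fix a assume a: "a \<in> A"
  then have af: "a \<in> rat_affine" using assms by auto
  let ?w = "\<lambda>i. y i - x i"
  have "move x 1 ?w = y" by (auto simp: move_def)
  then have "a ?w - a (\<lambda>_. 0) = a y - a x" using rat_affine_move[OF af, of x 1 ?w] by simp
  then have "a (move x s ?w) = (1 - s) * a x + s * a y"
    using rat_affine_move[OF af, of x s ?w] by (simp only:) (simp add: algebra_simps)
  then show "sgn (a x) = sgn (a (move x s ?w))"
    using sgn_convex_combination[of "a x" "a y" s] assms a by (auto simp: agree_def)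
qed

text \<open>\<open>t\<close> is one of the points \<open>r a\<close> or lies in a gap between them;
  the corresponding point or gap for \<open>r'\<close> supplies \<open>t'\<close>. A gap always
  contains a rational number.\<close>

lemma order_transfer:
  fixes r r' :: "'a \<Rightarrow> real"
  assumes fin: "finite S" and ord: "\<And>a b. a \<in> S \<Longrightarrow> b \<in> S \<Longrightarrow> sgn (r a - r b) = sgn (r' a - r' b)"
  shows "\<exists>t'. (\<forall>a\<in>S. sgn (t - r a) = sgn (t' - r' a)) \<and> ((\<forall>a\<in>S. r' a \<in> \<rat>) \<longrightarrow> t' \<in> \<rat>)"
proof (cases "\<exists>a\<in>S. r a = t")
  case True
  then obtain a where "a \<in> S" "r a = t" by auto
  then show ?thesis using ord by (intro exI[of _ "r' a"]) auto
next
  case False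
  have ord': "r a < r b \<Longrightarrow> r' a < r' b" if "a \<in> S" "b \<in> S" for a b
    using ord[OF that] by (auto simp: sgn_if split: if_splits)
  let ?L = "r' ` {a \<in> S. r a < t}" and ?U = "r' ` {a \<in> S. r a > t}"
  have finL: "finite ?L" and finU: "finite ?U" using fin by auto
  \<comment> \<open>The ends of the gap. If no point lies below it, \<open>l\<close> is 1 less than
    the upper end, or 0 when there are no points at all; if none lies above, \<open>u\<close> is
    \<open>l + 1\<close>.\<close>
  define l where "l = (if ?L = {} then (if ?U = {} then 0 else Min ?U - 1) else Max ?L)"
  define u where "u = (if ?U = {} then l + 1 else Min ?U)"
  have LU: "x < y" if "x \<in> ?L" "y \<in> ?U" for x y
    using that ord' by force
  have "l < u"
    using LU[OF Max_in[OF finL] Min_in[OF finU]] by (auto simp: l_def u_def)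
  then obtain t' where t': "t' \<in> \<rat>" "l < t'" "t' < u" using Rats_dense_in_real by blast
  have "sgn (t - r a) = sgn (t' - r' a)" if a: "a \<in> S" for a
  proof (cases "r a < t")
    case True
    then have "r' a \<in> ?L" using a by auto
    then have "r' a \<le> l" using Max_ge[OF finL] by (auto simp: l_def)
    then show ?thesis using True t' by simp
  next
    case F: False
    then have "r a > t" using False a by force
    then have "r' a \<in> ?U" using a by auto
    then have "u \<le> r' a" using Min_le[OF finU] by (auto simp: u_def)
    then show ?thesis using \<open>r a > t\<close> t' by simp
  qed
  then show ?thesis using t' by blast
qed

text \<open>
  Fourier--Motzkin elimination: the signs of \<open>A\<close> along a line parallel to the \<open>k\<close>-th axis are
  determined by the order of the roots on this line of the functions in \<open>A\<close>.
\<close>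

lemma eliminate_variable:
  assumes "finite A" "A \<subseteq> rat_affine"
  obtains B where "finite B" "B \<subseteq> rat_affine"
    "\<And>x y t. agree B x y \<Longrightarrow>
      \<exists>t'. agree A (x(k := t)) (y(k := t')) \<and> ((\<forall>i. y i \<in> \<rat>) \<longrightarrow> t' \<in> \<rat>)"
proof -
  define z :: "nat \<Rightarrow> real" where "z = (\<lambda>_. 0)"
  \<comment> \<open>\<open>c a\<close> is the coefficient of the k-th coordinate in
    \<open>a\<close>, and \<open>rt a x\<close> the root of \<open>a\<close> on the line through
    \<open>x\<close> parallel to the k-th axis. If \<open>c a = 0\<close>, division by zero makes
    \<open>rt a\<close> the zero function, which is still rational affine.\<close>
  define c where "c a = a (z(k := 1)) - a z" for a :: "(nat \<Rightarrow> real) \<Rightarrow> real"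
  define rt where "rt a x = (- 1 / c a) * a (x(k := 0))" for a x
  have c_Rats: "c a \<in> \<rat>" if "a \<in> A" for a
  proof -
    have a: "a \<in> rat_affine" using that assms by auto
    have "a (z(k := 1)) \<in> \<rat>" by (rule rat_affine_Rats[OF a]) (simp add: z_def)
    moreover have "a z \<in> \<rat>" by (rule rat_affine_Rats[OF a]) (simp add: z_def)
    ultimately show ?thesis by (simp add: c_def)
  qed
  have upd: "(\<lambda>x. a (x(k := 0))) \<in> rat_affine" if "a \<in> A" for a
  proof (rule rat_affine_comp[where M = "\<lambda>x. x(k := 0)"])
    show "(\<lambda>x. (x(k := 0)) j) \<in> rat_affine" for j
      using rat_affine.const[of 0] rat_affine.coord[of j] by (cases "j = k") auto
  qed (use that assms(2) in blast)
  have rt_affine: "rt a \<in> rat_affine" if "a \<in> A" for a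
  proof -
    have "- 1 / c a \<in> \<rat>" using c_Rats[OF that] by simp
    from rat_affine.scale[OF this upd[OF that]] show ?thesis by (simp add: rt_def[abs_def])
  qed
  have split: "a (x(k := t)) = a (x(k := 0)) + t * c a" if "a \<in> A" for a x t
  proof -
    have "x(k := t) = move (x(k := 0)) t (z(k := 1))" by (auto simp: move_def z_def)
    moreover have "a \<in> rat_affine" using that assms(2) by blast
    ultimately show ?thesis using rat_affine_move[of a "x(k := 0)" t "z(k := 1)"]
      by (simp add: c_def z_def)
  qed
  \<comment> \<open>The first family decides the signs of the functions with \<open>c a = 0\<close>,
    the second the order of the roots.\<close>
  define B where "B = (\<lambda>a x. a (x(k := 0))) ` A \<union> (\<lambda>(a, b) x. rt a x - rt b x) ` (A \<times> A)"
  show ?thesis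
  proof
    show "finite B" using assms by (auto simp: B_def)
    show "B \<subseteq> rat_affine"
      using upd rt_affine rat_affine_diff by (auto simp: B_def)
    fix x y t assume xy: "agree B x y"
    have B: "\<forall>a\<in>A. sgn (a (x(k := 0))) = sgn (a (y(k := 0)))"
      "\<forall>p\<in>A \<times> A. sgn ((\<lambda>(a, b) x. rt a x - rt b x) p x) = sgn ((\<lambda>(a, b) x. rt a x - rt b x) p y)"
      using xy unfolding agree_def B_def ball_Un ball_simps(9) by (rule conjunct1, rule conjunct2)
    have 1: "sgn (a (x(k := 0))) = sgn (a (y(k := 0)))" if "a \<in> A" for a
      using B(1) that by (rule bspec)
    have 2: "sgn (rt a x - rt b x) = sgn (rt a y - rt b y)" if "a \<in> A" "b \<in> A" for a b
      using bspec[OF B(2), of "(a, b)"] that by simp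
    have "\<exists>t'. (\<forall>a\<in>A. sgn (t - rt a x) = sgn (t' - rt a y)) \<and> ((\<forall>a\<in>A. rt a y \<in> \<rat>) \<longrightarrow> t' \<in> \<rat>)"
      by (rule order_transfer[OF assms(1) 2])
    then obtain t' where t': "\<forall>a\<in>A. sgn (t - rt a x) = sgn (t' - rt a y)"
      and rat: "(\<forall>a\<in>A. rt a y \<in> \<rat>) \<longrightarrow> t' \<in> \<rat>" by (elim exE conjE)
    have "sgn (a (x(k := t))) = sgn (a (y(k := t')))" if "a \<in> A" for a
    proof (cases "c a = 0")
      case True
      then show ?thesis using 1[OF that] by (simp add: split[OF that, of _ t] split[OF that, of _ t'])
    next
      case False
      have "a (x(k := s)) = c a * (s - rt a x)" for x s
        using False by (simp add: split[OF that, of x s] rt_def field_simps)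
      then show ?thesis using bspec[OF t' that] by (simp only: sgn_mult)
    qed
    then have "agree A (x(k := t)) (y(k := t'))" unfolding agree_def by (rule ballI)
    moreover have "t' \<in> \<rat>" if "\<forall>i. y i \<in> \<rat>"
      using rat rat_affine_Rats[OF rt_affine spec[OF that]] by simp
    ultimately show "\<exists>t'. agree A (x(k := t)) (y(k := t')) \<and> ((\<forall>i. y i \<in> \<rat>) \<longrightarrow> t' \<in> \<rat>)"
      by (intro exI[of _ t'] conjI impI)
  qed
qed

lemma Rn_iff: "x \<in> Rn n \<longleftrightarrow> (\<forall>i\<ge>n. x i = 0)"
  by (simp add: topspace_Euclidean_space)

text \<open>The rationality clause of \<open>eliminate_variable\<close> allows the coordinates to be
  made rational one at a time: the last one is eliminated, the others are replaced, and the last one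
  is then chosen anew.\<close>

lemma rational_agree:
  assumes "finite A" "A \<subseteq> rat_affine" "x \<in> Rn n"
  shows "\<exists>q\<in>Rn n. (\<forall>i. q i \<in> \<rat>) \<and> agree A x q"
  using assms
proof (induction n arbitrary: A x)
  case 0
  then show ?case by (intro bexI[of _ x]) (auto simp: Rn_iff)
next
  case (Suc n)
  obtain B where B: "finite B" "B \<subseteq> rat_affine"
    "\<And>x y t. agree B x y \<Longrightarrow>
      \<exists>t'. agree A (x(n := t)) (y(n := t')) \<and> ((\<forall>i. y i \<in> \<rat>) \<longrightarrow> t' \<in> \<rat>)"
    using eliminate_variable[OF Suc.prems(1,2), of n] by blast
  have "x(n := 0) \<in> Rn n" using Suc.prems(3) by (auto simp: Rn_iff)
  from Suc.IH[OF B(1,2) this] obtain q where q: "q \<in> Rn n" "\<forall>i. q i \<in> \<rat>" "agree B (x(n := 0)) q"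
    by blast
  from B(3)[OF q(3), of "x n"] q(2) obtain t where "agree A x (q(n := t))" "t \<in> \<rat>" by auto
  moreover have "q(n := t) \<in> Rn (Suc n)" "\<forall>i. (q(n := t)) i \<in> \<rat>"
    using q \<open>t \<in> \<rat>\<close> by (auto simp: Rn_iff)
  ultimately show ?case by blast
qed

text \<open>\<open>X\<close> is a union of traces on \<open>U\<close> of cells of one finite
  arrangement. The ambient set is \<open>UNIV\<close> while auxiliary variables are being eliminated
  and \<open>Rn n\<close> for the final sets.\<close>

definition semilinear_on :: "(nat \<Rightarrow> real) set \<Rightarrow> (nat \<Rightarrow> real) set \<Rightarrow> bool" where
  "semilinear_on U X \<longleftrightarrow> X \<subseteq> U \<and>
    (\<exists>A. finite A \<and> A \<subseteq> rat_affine \<and> (\<forall>x\<in>X. \<forall>y\<in>U. agree A x y \<longrightarrow> y \<in> X))"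

lemma semilinear_onI:
  assumes "X \<subseteq> U" "finite A" "A \<subseteq> rat_affine"
    "\<And>x y. x \<in> X \<Longrightarrow> y \<in> U \<Longrightarrow> agree A x y \<Longrightarrow> y \<in> X"
  shows "semilinear_on U X"
  using assms unfolding semilinear_on_def by blast

lemma semilinear_onE:
  assumes "semilinear_on U X"
  obtains A where "X \<subseteq> U" "finite A" "A \<subseteq> rat_affine"
    "\<And>x y. x \<in> X \<Longrightarrow> y \<in> U \<Longrightarrow> agree A x y \<Longrightarrow> y \<in> X"
  using assms unfolding semilinear_on_def by blast

lemma semilinear_on_Diff:
  assumes "semilinear_on U X" "semilinear_on U Y"
  shows "semilinear_on U (X - Y)"
proof -
  obtain A where A: "X \<subseteq> U" "finite A" "A \<subseteq> rat_affine"
    "\<And>x y. x \<in> X \<Longrightarrow> y \<in> U \<Longrightarrow> agree A x y \<Longrightarrow> y \<in> X"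
    by (rule semilinear_onE[OF assms(1)]) (rule that)
  obtain B where B: "Y \<subseteq> U" "finite B" "B \<subseteq> rat_affine"
    "\<And>x y. x \<in> Y \<Longrightarrow> y \<in> U \<Longrightarrow> agree B x y \<Longrightarrow> y \<in> Y"
    by (rule semilinear_onE[OF assms(2)]) (rule that)
  show ?thesis
  proof (rule semilinear_onI[of _ _ "A \<union> B"])
    fix x y assume *: "x \<in> X - Y" "y \<in> U" "agree (A \<union> B) x y"
    then have "agree A x y" "agree B y x" by (auto simp: agree_Un intro: agree_sym)
    then show "y \<in> X - Y" using * A(1,4) B(4)[of y x] by blast
  qed (use A B in auto)
qed

lemma semilinear_on_Int:
  assumes "semilinear_on U X" "semilinear_on U Y"
  shows "semilinear_on U (X \<inter> Y)"
  using semilinear_on_Diff[OF assms(1) semilinear_on_Diff[OF assms]] by (simp add: Diff_Diff_Int)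

lemma semilinear_on_UN:
  assumes "finite I" "\<And>i. i \<in> I \<Longrightarrow> semilinear_on U (X i)"
  shows "semilinear_on U (\<Union>i\<in>I. X i)"
proof -
  have sub: "X i \<subseteq> U" if "i \<in> I" for i
    using assms(2)[OF that] by (simp add: semilinear_on_def)
  have "\<forall>i\<in>I. \<exists>A. finite A \<and> A \<subseteq> rat_affine \<and> (\<forall>x\<in>X i. \<forall>y\<in>U. agree A x y \<longrightarrow> y \<in> X i)"
    using assms(2) by (simp add: semilinear_on_def)
  from bchoice[OF this] obtain A where A: "\<forall>i\<in>I. finite (A i) \<and> A i \<subseteq> rat_affine \<and>
      (\<forall>x\<in>X i. \<forall>y\<in>U. agree (A i) x y \<longrightarrow> y \<in> X i)" ..
  show ?thesis
  proof (rule semilinear_onI[of _ _ "\<Union>i\<in>I. A i"])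
    fix x y assume "x \<in> (\<Union>i\<in>I. X i)" and y: "y \<in> U" "agree (\<Union>i\<in>I. A i) x y"
    then obtain i where i: "i \<in> I" "x \<in> X i" by blast
    then have "agree (A i) x y" using agree_mono[OF y(2)] by blast
    then have "y \<in> X i" using bspec[OF A i(1)] i(2) y(1) by simp
    then show "y \<in> (\<Union>i\<in>I. X i)" using i(1) by blast
  next
    show "(\<Union>i\<in>I. X i) \<subseteq> U" using sub by blast
  qed (use A assms(1) in auto)
qed

lemma semilinear_on_Un:
  assumes "semilinear_on U X" "semilinear_on U Y"
  shows "semilinear_on U (X \<union> Y)"
  using semilinear_on_UN[of "{X, Y}" U id] assms by auto

lemma semilinear_on_UNIV_Compl: "semilinear_on UNIV X \<Longrightarrow> semilinear_on UNIV (- X)"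
  using semilinear_on_Diff[OF semilinear_onI[of UNIV UNIV "{}"]] by (auto simp: Compl_eq_Diff_UNIV)

lemma semilinear_on_sgn:
  assumes "f \<in> rat_affine"
  shows "semilinear_on U {x \<in> U. Q (sgn (f x))}"
  by (rule semilinear_onI[of _ _ "{f}"]) (use assms in \<open>auto simp: agree_def\<close>)

lemma semilinear_on_pos:
  assumes "f \<in> rat_affine"
  shows "semilinear_on U {x \<in> U. f x > 0}"
  using semilinear_on_sgn[OF assms, of U "\<lambda>s. s = 1"] by (simp add: sgn_1_pos)

lemma semilinear_on_zero:
  assumes "f \<in> rat_affine"
  shows "semilinear_on U {x \<in> U. f x = 0}"
  using semilinear_on_sgn[OF assms, of U "\<lambda>s. s = 0"] by (simp add: sgn_zero_iff)

lemma semilinear_on_vimage: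
  assumes "semilinear_on V X" "\<And>k. (\<lambda>x. M x k) \<in> rat_affine" "\<And>x. x \<in> U \<Longrightarrow> M x \<in> V"
  shows "semilinear_on U {x \<in> U. M x \<in> X}"
proof -
  obtain A where A: "X \<subseteq> V" "finite A" "A \<subseteq> rat_affine"
    "\<And>x y. x \<in> X \<Longrightarrow> y \<in> V \<Longrightarrow> agree A x y \<Longrightarrow> y \<in> X"
    by (rule semilinear_onE[OF assms(1)]) (rule that)
  show ?thesis
  proof (rule semilinear_onI[of _ _ "(\<lambda>a x. a (M x)) ` A"])
    show "(\<lambda>a x. a (M x)) ` A \<subseteq> rat_affine" using A(3) rat_affine_comp assms(2) by auto
    fix x y assume *: "x \<in> {x \<in> U. M x \<in> X}" "y \<in> U" "agree ((\<lambda>a x. a (M x)) ` A) x y"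
    then have "agree A (M x) (M y)" by (auto simp: agree_def)
    then show "y \<in> {x \<in> U. M x \<in> X}" using * A assms(3) by auto
  qed (use A in auto)
qed

text \<open>Quantifier elimination: the family \<open>B\<close> obtained from \<open>A\<close>
  serves for the projection, because it carries a witness at \<open>x\<close> over to a witness at
  \<open>y\<close>.\<close>

lemma semilinear_on_Ex:
  assumes "semilinear_on UNIV S"
  shows "semilinear_on UNIV {x. \<exists>t. x(k := t) \<in> S}"
proof -
  obtain A where A: "finite A" "A \<subseteq> rat_affine" "\<And>x y. x \<in> S \<Longrightarrow> agree A x y \<Longrightarrow> y \<in> S"
    by (rule semilinear_onE[OF assms]) (rule that; simp)
  obtain B where B: "finite B" "B \<subseteq> rat_affine"
    "\<And>x y t. agree B x y \<Longrightarrow>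
      \<exists>t'. agree A (x(k := t)) (y(k := t')) \<and> ((\<forall>i. y i \<in> \<rat>) \<longrightarrow> t' \<in> \<rat>)"
    using eliminate_variable[OF A(1,2), of k] by blast
  show ?thesis
  proof (rule semilinear_onI[of _ _ B])
    fix x y assume "x \<in> {x. \<exists>t. x(k := t) \<in> S}" "agree B x y"
    then show "y \<in> {x. \<exists>t. x(k := t) \<in> S}" using A(3) B(3) by blast
  qed (use B in auto)
qed

text \<open>Quantifies over a whole vector, stored in the coordinates from \<open>m\<close> to
  \<open>m + k - 1\<close>; this is needed to describe lineality spaces.\<close>

lemma semilinear_on_Ex_block:
  assumes "semilinear_on UNIV S"
  shows "semilinear_on UNIV {x. \<exists>w. (\<lambda>i. if m \<le> i \<and> i < m + k then w i else x i) \<in> S}"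
  using assms
proof (induction k arbitrary: S)
  case 0
  have "(\<lambda>i. if m \<le> i \<and> i < m + 0 then w i else x i) = x" for w x :: "nat \<Rightarrow> real"
    by (auto simp: fun_eq_iff)
  then show ?case using 0 by simp
next
  case (Suc k)
  have "(\<exists>w. (\<lambda>i. if m \<le> i \<and> i < m + Suc k then w i else x i) \<in> S) \<longleftrightarrow>
    (\<exists>w. \<exists>t. (\<lambda>i. if m \<le> i \<and> i < m + k then w i else x i)(m + k := t) \<in> S)" (is "?L \<longleftrightarrow> ?R") for x
  proof
    assume ?L
    then obtain w where w: "(\<lambda>i. if m \<le> i \<and> i < m + Suc k then w i else x i) \<in> S" by blast
    have "(\<lambda>i. if m \<le> i \<and> i < m + Suc k then w i else x i) =
      (\<lambda>i. if m \<le> i \<and> i < m + k then w i else x i)(m + k := w (m + k))"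
      by (auto simp: fun_eq_iff)
    with w have "(\<lambda>i. if m \<le> i \<and> i < m + k then w i else x i)(m + k := w (m + k)) \<in> S"
      by (simp only:)
    then show ?R by (intro exI)
  next
    assume ?R
    then obtain w t where w: "(\<lambda>i. if m \<le> i \<and> i < m + k then w i else x i)(m + k := t) \<in> S"
      by blast
    have "(\<lambda>i. if m \<le> i \<and> i < m + k then w i else x i)(m + k := t) =
      (\<lambda>i. if m \<le> i \<and> i < m + Suc k then (w(m + k := t)) i else x i)"
      by (auto simp: fun_eq_iff)
    with w have "(\<lambda>i. if m \<le> i \<and> i < m + Suc k then (w(m + k := t)) i else x i) \<in> S"
      by (simp only:)
    then show ?L by (rule exI[of _ "w(m + k := t)"])
  qed
  then show ?case using Suc.IH[OF semilinear_on_Ex[OF Suc.prems, of "m + k"]] by simp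
qed

definition restr :: "nat \<Rightarrow> (nat \<Rightarrow> real) \<Rightarrow> nat \<Rightarrow> real" where
  "restr n x = (\<lambda>i. if i < n then x i else 0)"

lemma restr_id: "x \<in> Rn n \<Longrightarrow> restr n x = x"
  by (auto simp: restr_def Rn_iff fun_eq_iff)

lemma semilinear_on_restrict:
  assumes "semilinear_on UNIV S"
  shows "semilinear_on U (U \<inter> S)"
proof -
  obtain A where "finite A" "A \<subseteq> rat_affine" "\<And>x y. x \<in> S \<Longrightarrow> agree A x y \<Longrightarrow> y \<in> S"
    by (rule semilinear_onE[OF assms]) (rule that; simp)
  then show ?thesis by (intro semilinear_onI[of _ _ A]) auto
qed

section \<open>Definability in the reals with addition, order and 1\<close>

lemma tm_val_affine: "(\<lambda>e. tm_val e t) \<in> rat_affine"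
  by (induction t) (auto intro: rat_affine.intros)

lemma sat_semilinear: "IntS \<notin> fm_syms p \<Longrightarrow> semilinear_on UNIV {e. sat e p}"
proof (induction p)
  case (Equal s t)
  show ?case
    using semilinear_on_zero[OF rat_affine_diff[OF tm_val_affine[of s] tm_val_affine[of t]], of UNIV]
    by simp
next
  case (Less s t)
  show ?case
    using semilinear_on_pos[OF rat_affine_diff[OF tm_val_affine[of t] tm_val_affine[of s]], of UNIV]
    by simp
next
  case (Neg p)
  then show ?case using semilinear_on_UNIV_Compl[of "{e. sat e p}"] by (simp add: Collect_neg_eq)
next
  case (Conj p q)
  then show ?case using semilinear_on_Int[of UNIV "{e. sat e p}" "{e. sat e q}"]
    by (simp add: Collect_conj_eq)
next
  case (Exists k p)
  then show ?case using semilinear_on_Ex[of "{e. sat e p}" k] by simp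
qed simp

lemma R1_definable_imp_semilinear:
  assumes "R1_definable n X"
  shows "semilinear_on (Rn n) X"
proof -
  obtain p where p: "fm_syms p \<subseteq> {PlusS, LessS, OneS}" "X = {x \<in> Rn n. sat x p}"
    using assms unfolding definable_def by blast
  have "IntS \<notin> fm_syms p" using p(1) by auto
  from semilinear_on_restrict[OF sat_semilinear[OF this], of "Rn n"]
  show ?thesis by (simp add: p(2) Int_def)
qed

primrec add_multiple :: "nat \<Rightarrow> tm \<Rightarrow> tm \<Rightarrow> tm" where
  "add_multiple 0 s t = t"
| "add_multiple (Suc k) s t = Add s (add_multiple k s t)"

lemma tm_val_add_multiple [simp]: "tm_val e (add_multiple k s t) = real k * tm_val e s + tm_val e t"
  by (induction k) (simp_all add: algebra_simps)

definition R1_term :: "nat \<Rightarrow> tm \<Rightarrow> bool" where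
  "R1_term n t \<longleftrightarrow> tm_syms t \<subseteq> {PlusS, OneS} \<and> tm_vars t \<subseteq> {..<n}"

lemma R1_term_add_multiple: "R1_term n s \<Longrightarrow> R1_term n t \<Longrightarrow> R1_term n (add_multiple k s t)"
  by (induction k) (auto simp: R1_term_def)

lemma R1_term_One [simp]: "R1_term n One"
  by (simp add: R1_term_def)

text \<open>
  The signature has neither 0 nor subtraction, so a rational affine function is represented,
  up to a positive factor, by a difference of two terms.
\<close>

lemma rat_affine_terms:
  assumes "f \<in> rat_affine"
  shows "\<exists>m s t. m > 0 \<and> R1_term n s \<and> R1_term n t \<and>
    (\<forall>x\<in>Rn n. real m * f x = tm_val x s - tm_val x t)"
  using assms
proof induction
  case (coord k)
  show ?case
  proof (cases "k < n")
    case True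
    \<comment> \<open>\<open>One\<close> on both sides makes up for the missing term 0. In the other
      case the coordinate vanishes on \<open>Rn n\<close>, and \<open>One\<close> against
      \<open>One\<close> represents it.\<close>
    then show ?thesis
      by (intro exI[of _ 1] exI[of _ "Add (Var k) One"] exI[of _ One]) (auto simp: R1_term_def)
  next
    case False
    then show ?thesis
      by (intro exI[of _ 1] exI[of _ One] exI[of _ One]) (auto simp: Rn_iff)
  qed
next
  case (const c)
  then obtain p and q :: nat where c: "c = real_of_int p / real q" "q \<noteq> 0"
    unfolding Rats_eq_int_div_nat by blast
  then show ?case
    by (intro exI[of _ q] exI[of _ "add_multiple (nat p) One One"]
        exI[of _ "add_multiple (nat (- p)) One One"]) (auto simp: R1_term_add_multiple)
next
  case (add f g)
  obtain m s t where 1: "m > 0" "R1_term n s" "R1_term n t"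
    "\<forall>x\<in>Rn n. real m * f x = tm_val x s - tm_val x t" using add.IH(1) by (elim exE conjE)
  obtain m' s' t' where 2: "m' > 0" "R1_term n s'" "R1_term n t'"
    "\<forall>x\<in>Rn n. real m' * g x = tm_val x s' - tm_val x t'" using add.IH(2) by (elim exE conjE)
  let ?s = "add_multiple m' s (add_multiple m s' One)"
  let ?t = "add_multiple m' t (add_multiple m t' One)"
  have "real (m * m') * (f x + g x) = tm_val x ?s - tm_val x ?t" if "x \<in> Rn n" for x
  proof -
    have "real (m * m') * (f x + g x) = real m' * (real m * f x) + real m * (real m' * g x)"
      by (simp add: algebra_simps)
    also have "\<dots> = real m' * (tm_val x s - tm_val x t) + real m * (tm_val x s' - tm_val x t')"
      using bspec[OF 1(4) that] bspec[OF 2(4) that] by simp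
    finally show ?thesis by (simp add: algebra_simps)
  qed
  moreover have "m * m' > 0" "R1_term n ?s" "R1_term n ?t"
    using 1(1,2,3) 2(1,2,3) by (auto intro!: R1_term_add_multiple)
  ultimately show ?case by blast
next
  case (scale c f)
  obtain m s t where 1: "m > 0" "R1_term n s" "R1_term n t"
    "\<forall>x\<in>Rn n. real m * f x = tm_val x s - tm_val x t" using scale.IH by (elim exE conjE)
  obtain p and q :: nat where c: "c = real_of_int p / real q" "q \<noteq> 0"
    using scale.hyps unfolding Rats_eq_int_div_nat by blast
  \<comment> \<open>The positive and the negative part of \<open>p\<close>; multiplication by the
    negative part exchanges the roles of \<open>s\<close> and \<open>t\<close>.\<close>
  have p: "real_of_int p = real (nat p) - real (nat (- p))" by auto
  let ?s = "add_multiple (nat p) s (add_multiple (nat (- p)) t One)"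
  let ?t = "add_multiple (nat p) t (add_multiple (nat (- p)) s One)"
  have "real (q * m) * (c * f x) = tm_val x ?s - tm_val x ?t" if "x \<in> Rn n" for x
  proof -
    have "real (q * m) * (c * f x) = real_of_int p * (real m * f x)"
      using c by simp
    also have "\<dots> = (real (nat p) - real (nat (- p))) * (tm_val x s - tm_val x t)"
      using bspec[OF 1(4) that] p by simp
    finally show ?thesis by (simp add: algebra_simps)
  qed
  moreover have "q * m > 0" "R1_term n ?s" "R1_term n ?t"
    using 1(1,2,3) c by (auto intro!: R1_term_add_multiple)
  ultimately show ?case by blast
qed

lemma definable_Int:
  assumes "definable L n X" "definable L n Y"
  shows "definable L n (X \<inter> Y)"
proof -
  obtain p q where "fm_syms p \<subseteq> L" "free_vars p \<subseteq> {..<n}" "X = {x \<in> Rn n. sat x p}"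
    "fm_syms q \<subseteq> L" "free_vars q \<subseteq> {..<n}" "Y = {x \<in> Rn n. sat x q}"
    using assms unfolding definable_def by blast
  then show ?thesis unfolding definable_def by (intro exI[of _ "Conj p q"]) auto
qed

lemma definable_Diff:
  assumes "definable L n X" "definable L n Y"
  shows "definable L n (X - Y)"
proof -
  obtain p q where "fm_syms p \<subseteq> L" "free_vars p \<subseteq> {..<n}" "X = {x \<in> Rn n. sat x p}"
    "fm_syms q \<subseteq> L" "free_vars q \<subseteq> {..<n}" "Y = {x \<in> Rn n. sat x q}"
    using assms unfolding definable_def by blast
  then show ?thesis unfolding definable_def by (intro exI[of _ "Conj p (Neg q)"]) auto
qed

lemma R1_definable_Rn: "R1_definable n (Rn n)"
  unfolding definable_def by (intro exI[of _ "Equal One One"]) auto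

lemma definable_Un:
  assumes "definable L n X" "definable L n Y" "definable L n (Rn n)"
  shows "definable L n (X \<union> Y)"
proof -
  have "X \<subseteq> Rn n" "Y \<subseteq> Rn n" using assms(1,2) unfolding definable_def by auto
  then have "X \<union> Y = Rn n - ((Rn n - X) \<inter> (Rn n - Y))" by blast
  then show ?thesis using assms by (simp only: definable_Int definable_Diff)
qed

lemma R1_definable_sgn:
  assumes "f \<in> rat_affine"
  shows "R1_definable n {x \<in> Rn n. sgn (f x) = c}"
proof -
  obtain m s t where 1: "m > 0" "R1_term n s" "R1_term n t"
    "\<forall>x\<in>Rn n. real m * f x = tm_val x s - tm_val x t"
    using rat_affine_terms[OF assms, of n] by (elim exE conjE)
  have syms: "tm_syms s \<subseteq> {PlusS, LessS, OneS}" "tm_syms t \<subseteq> {PlusS, LessS, OneS}"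
    "tm_vars s \<subseteq> {..<n}" "tm_vars t \<subseteq> {..<n}"
    using 1(2,3) by (auto simp: R1_term_def)
  have sgn: "sgn (f x) = sgn (tm_val x s - tm_val x t)" if "x \<in> Rn n" for x
    using bspec[OF 1(4) that] 1(1) by (metis mult_1 of_nat_0_less_iff sgn_mult sgn_pos)
  have sgn_cases: "(c = 0 \<longleftrightarrow> d = 0) \<and> (c > 0 \<longleftrightarrow> d > 0) \<and> (c < 0 \<longleftrightarrow> d < 0)"
    if "sgn c = sgn d" for c d :: real
    using that by (auto simp: sgn_if split: if_splits)
  have zero: "f x = 0 \<longleftrightarrow> tm_val x s = tm_val x t"
    and pos: "f x > 0 \<longleftrightarrow> tm_val x s > tm_val x t"
    and neg: "f x < 0 \<longleftrightarrow> tm_val x s < tm_val x t" if "x \<in> Rn n" for x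
    using sgn_cases[OF sgn[OF that]] by auto
  have "R1_definable n {x \<in> Rn n. f x = 0}"
    unfolding definable_def using syms by (intro exI[of _ "Equal s t"]) (auto simp: zero)
  moreover have "R1_definable n {x \<in> Rn n. f x > 0}"
    unfolding definable_def using syms by (intro exI[of _ "Less t s"]) (auto simp: pos)
  moreover have "R1_definable n {x \<in> Rn n. f x < 0}"
    unfolding definable_def using syms by (intro exI[of _ "Less s t"]) (auto simp: neg)
  moreover have "R1_definable n {}"
    using definable_Diff[OF R1_definable_Rn R1_definable_Rn] by simp
  moreover have "{x \<in> Rn n. sgn (f x) = c} = (if c = 0 then {x \<in> Rn n. f x = 0}
     else if c = 1 then {x \<in> Rn n. f x > 0} else if c = -1 then {x \<in> Rn n. f x < 0} else {})"
    by (auto simp: sgn_if split: if_splits)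
  ultimately show ?thesis by (simp split: if_splits)
qed

lemma R1_definable_if_agree:
  assumes "finite A" "A \<subseteq> rat_affine" "X \<subseteq> Rn n"
    "\<And>x y. x \<in> X \<Longrightarrow> y \<in> Rn n \<Longrightarrow> agree A x y \<Longrightarrow> y \<in> X"
  shows "R1_definable n X"
  using assms
proof (induction A arbitrary: X rule: finite_induct)
  case empty
  then have "X = {} \<or> X = Rn n" by (auto simp: agree_def)
  then show ?case
    using R1_definable_Rn definable_Diff[OF R1_definable_Rn R1_definable_Rn] by auto
next
  case (insert a A)
  \<comment> \<open>The part of \<open>X\<close> on which \<open>a\<close> has sign
    \<open>c\<close>, saturated under agreement for the smaller family. Intersecting with the sign
    condition on \<open>a\<close> again gives back exactly that part of \<open>X\<close>.\<close>
  define Y where "Y c = {y \<in> Rn n. \<exists>x\<in>X. sgn (a x) = c \<and> agree A x y}" for c :: real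
  have def_Y: "R1_definable n (Y c \<inter> {x \<in> Rn n. sgn (a x) = c})" for c
  proof (rule definable_Int)
    show "R1_definable n (Y c)"
    proof (rule insert.IH)
      show "y \<in> Y c" if "x \<in> Y c" "y \<in> Rn n" "agree A x y" for x y
        using that agree_trans[of A _ x y] by (auto simp: Y_def)
    qed (use insert.prems in \<open>auto simp: Y_def\<close>)
  qed (use insert.prems in \<open>auto intro: R1_definable_sgn\<close>)
  have "x \<in> (\<Union>c\<in>{0, 1, -1}. Y c \<inter> {x \<in> Rn n. sgn (a x) = c})" if "x \<in> X" for x
  proof -
    have "x \<in> Y (sgn (a x)) \<inter> {y \<in> Rn n. sgn (a y) = sgn (a x)}"
      using that insert.prems(2) by (auto simp: Y_def)
    moreover have "sgn (a x) \<in> {0, 1, -1}" by (simp add: sgn_if)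
    ultimately show ?thesis by blast
  qed
  moreover have "y \<in> X" if "y \<in> Y c \<inter> {x \<in> Rn n. sgn (a x) = c}" for y c
    using that insert.prems(3)[of _ y] by (auto simp: Y_def agree_insert)
  ultimately have "X = (\<Union>c\<in>{0, 1, -1}. Y c \<inter> {x \<in> Rn n. sgn (a x) = c})"
    by blast
  then have "X = (Y 0 \<inter> {x \<in> Rn n. sgn (a x) = 0}) \<union> ((Y 1 \<inter> {x \<in> Rn n. sgn (a x) = 1}) \<union>
      (Y (-1) \<inter> {x \<in> Rn n. sgn (a x) = -1}))"
    by simp
  then show ?case
    using definable_Un[OF def_Y definable_Un[OF def_Y def_Y R1_definable_Rn] R1_definable_Rn] by simp
qed

text \<open>From here on definability in the reals with +, < and 1 is handled through cells only,
  without syntax.\<close>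

lemma R1_definable_iff_semilinear: "R1_definable n X \<longleftrightarrow> semilinear_on (Rn n) X"
proof
  assume "semilinear_on (Rn n) X"
  then obtain A where "X \<subseteq> Rn n" "finite A" "A \<subseteq> rat_affine"
    "\<And>x y. x \<in> X \<Longrightarrow> y \<in> Rn n \<Longrightarrow> agree A x y \<Longrightarrow> y \<in> X"
    by (rule semilinear_onE) (rule that)
  then show "R1_definable n X" by (intro R1_definable_if_agree)
qed (rule R1_definable_imp_semilinear)

section \<open>Integer and fractional parts\<close>

abbreviation fracs :: "(nat \<Rightarrow> real) \<Rightarrow> nat \<Rightarrow> real" where
  "fracs x \<equiv> (\<lambda>i. frac (x i))"

abbreviation floors :: "(nat \<Rightarrow> real) \<Rightarrow> nat \<Rightarrow> int" where
  "floors x \<equiv> (\<lambda>i. \<lfloor>x i\<rfloor>)"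

lemma tm_val_Ints: "(\<And>i. x i \<in> \<int>) \<Longrightarrow> tm_val x t \<in> \<int>"
  by (induction t) auto

text \<open>\<open>f x\<close> is an integer depending only on the floors, plus the linear part of
  \<open>f\<close> at the fractional parts. The latter is bounded, so finitely many integer
  thresholds suffice, uniformly in the floors.\<close>

lemma integral_affine_fracs:
  assumes f: "f \<in> rat_affine" and int: "\<And>x. (\<And>i. x i \<in> \<int>) \<Longrightarrow> f x \<in> \<int>"
  obtains A where "finite A" "A \<subseteq> rat_affine"
    "\<And>x y. floors x = floors y \<Longrightarrow> agree A (fracs x) (fracs y) \<Longrightarrow>
      sgn (f x) = sgn (f y) \<and> (f x \<in> \<int> \<longleftrightarrow> f y \<in> \<int>)"
proof -
  define b where "b x = f x - f (\<lambda>_. 0)" for x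
  obtain K where "K \<ge> 0" and K: "\<forall>r\<ge>0. \<forall>w. (\<forall>i. \<bar>w i\<bar> \<le> r) \<longrightarrow> \<bar>f w - f (\<lambda>_. 0)\<bar> \<le> K * r"
    using rat_affine_bounded[OF f] by (elim exE conjE)
  have bK: "\<bar>b (fracs x)\<bar> \<le> K" for x
    using K[rule_format, of 1 "fracs x"] by (simp add: b_def frac_lt_1 less_imp_le)
  define N where "N = \<lceil>K\<rceil>"
  have KN: "K \<le> of_int N" by (simp add: N_def)
  \<comment> \<open>For an integer m with |m| \<le> N the sign of m + \<open>b\<close> is recorded
    here; for larger |m| it is the sign of m, because \<open>b\<close> is at most N in absolute
    value on fractional parts.\<close>
  define A where "A = (\<lambda>k x. b x + of_int k) ` {-N..N}"
  have split: "f x = f (\<lambda>i. of_int \<lfloor>x i\<rfloor>) + b (fracs x)" for x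
  proof -
    have "x = move (\<lambda>i. of_int \<lfloor>x i\<rfloor>) 1 (fracs x)" by (simp add: move_def frac_def)
    then show ?thesis using rat_affine_move[OF f, of "\<lambda>i. of_int \<lfloor>x i\<rfloor>" 1 "fracs x"]
      by (simp add: b_def)
  qed
  have "f (\<lambda>_. 0) \<in> \<int>" by (rule int) simp
  then have f0: "f (\<lambda>_. 0) \<in> \<rat>" by (simp add: Ints_subset_Rats[THEN subsetD])
  have b_affine: "b \<in> rat_affine"
    unfolding b_def using rat_affine_diff[OF f rat_affine.const[OF f0]] .
  show ?thesis
  proof
    show "finite A" by (simp add: A_def)
    show "A \<subseteq> rat_affine"
      unfolding A_def using rat_affine.add[OF b_affine rat_affine.const] by auto
    fix x y assume fl: "floors x = floors y" and A: "agree A (fracs x) (fracs y)"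
    obtain m where m: "f (\<lambda>i. of_int \<lfloor>x i\<rfloor>) = of_int m"
      using int[of "\<lambda>i. of_int \<lfloor>x i\<rfloor>"] by (auto elim: Ints_cases)
    have "f (\<lambda>i. of_int \<lfloor>y i\<rfloor>) = of_int m"
      using m fl by (simp add: fun_eq_iff)
    then have xy: "f x = of_int m + b (fracs x)" "f y = of_int m + b (fracs y)"
      using m split[of x] split[of y] by simp_all
    have sgn: "sgn (b (fracs x) + of_int k) = sgn (b (fracs y) + of_int k)" if "k \<in> {-N..N}" for k
      using A that unfolding agree_def A_def by auto
    have "sgn (f x) = sgn (f y)"
    proof -
      consider "m \<in> {-N..N}" | "m > N" | "m < -N" by force
      then show ?thesis
      proof cases
        case 1
        from sgn[OF this] show ?thesis unfolding xy by (simp add: add.commute)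
      next
        case 2
        then have "real_of_int m > real_of_int N" by simp
        then have "f x > 0" "f y > 0" unfolding xy using bK[of x] bK[of y] KN by linarith+
        then show ?thesis by simp
      next
        case 3
        then have "real_of_int m < real_of_int (-N)" by (simp only: of_int_less_iff)
        then have "f x < 0" "f y < 0" unfolding xy using bK[of x] bK[of y] KN by auto
        then show ?thesis by simp
      qed
    qed
    \<comment> \<open>\<open>f z\<close> is an integer iff \<open>b (fracs z)\<close> is one, and by
      the bound this integer is then the negative of a recorded threshold.\<close>
    moreover have *: "f z \<in> \<int> \<longleftrightarrow> (\<exists>k\<in>{-N..N}. sgn (b (fracs z) + of_int k) = 0)"
      if "f z = of_int m + b (fracs z)" for z
    proof
      assume "f z \<in> \<int>"
      then have "b (fracs z) \<in> \<int>" using that Ints_diff[of "f z" "of_int m"] by simp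
      then obtain k where k: "b (fracs z) = of_int k" by (auto elim: Ints_cases)
      then have "\<bar>real_of_int k\<bar> \<le> of_int N" using bK[of z] KN by simp
      then have "-k \<in> {-N..N}" by simp linarith
      then show "\<exists>k\<in>{-N..N}. sgn (b (fracs z) + of_int k) = 0"
        using k by (intro bexI[of _ "-k"]) auto
    next
      assume "\<exists>k\<in>{-N..N}. sgn (b (fracs z) + of_int k) = 0"
      then obtain k where "b (fracs z) + of_int k = 0" by (auto simp: sgn_zero_iff)
      then have "f z = of_int (m - k)" using that by simp
      then show "f z \<in> \<int>" by (simp only: Ints_of_int)
    qed
    ultimately show "sgn (f x) = sgn (f y) \<and> (f x \<in> \<int> \<longleftrightarrow> f y \<in> \<int>)"
      using *[OF xy(1)] *[OF xy(2)] sgn by auto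
  qed
qed

text \<open>The integers need no elimination: the floors of the two points are equal, so an
  existential witness for one point keeps its integer part for the other, and only its fractional
  part is adjusted by \<open>eliminate_variable\<close>.\<close>

lemma sat_floors_fracs:
  obtains A where "finite A" "A \<subseteq> rat_affine"
    "\<And>x y. floors x = floors y \<Longrightarrow> agree A (fracs x) (fracs y) \<Longrightarrow> sat x p \<longleftrightarrow> sat y p"
proof -
  \<comment> \<open>One implication suffices in the induction, since the hypotheses are symmetric in
    \<open>x\<close> and \<open>y\<close>.\<close>
  have "\<exists>A. finite A \<and> A \<subseteq> rat_affine \<and>
    (\<forall>x y. floors x = floors y \<longrightarrow> agree A (fracs x) (fracs y) \<longrightarrow> sat x p \<longrightarrow> sat y p)"
  proof (induction p)
    case (Equal s t)
    obtain A where A: "finite A" "A \<subseteq> rat_affine" "\<And>x y. floors x = floors y \<Longrightarrow>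
      agree A (fracs x) (fracs y) \<Longrightarrow> sgn (tm_val x s - tm_val x t) = sgn (tm_val y s - tm_val y t) \<and>
      (tm_val x s - tm_val x t \<in> \<int> \<longleftrightarrow> tm_val y s - tm_val y t \<in> \<int>)"
      by (rule integral_affine_fracs[OF rat_affine_diff[OF tm_val_affine[of s] tm_val_affine[of t]]
          Ints_diff[OF tm_val_Ints tm_val_Ints]]) (assumption | rule that)+
    have "sat y (Equal s t)"
      if "floors x = floors y" "agree A (fracs x) (fracs y)" "sat x (Equal s t)" for x y
      using A(3)[OF that(1,2)] that(3) by (simp add: sgn_zero_iff)
    then show ?case using A(1,2) by (intro exI[of _ A] conjI allI impI)
  next
    case (Less s t)
    obtain A where A: "finite A" "A \<subseteq> rat_affine" "\<And>x y. floors x = floors y \<Longrightarrow>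
      agree A (fracs x) (fracs y) \<Longrightarrow> sgn (tm_val x t - tm_val x s) = sgn (tm_val y t - tm_val y s) \<and>
      (tm_val x t - tm_val x s \<in> \<int> \<longleftrightarrow> tm_val y t - tm_val y s \<in> \<int>)"
      by (rule integral_affine_fracs[OF rat_affine_diff[OF tm_val_affine[of t] tm_val_affine[of s]]
          Ints_diff[OF tm_val_Ints tm_val_Ints]]) (assumption | rule that)+
    have "sat y (Less s t)"
      if "floors x = floors y" "agree A (fracs x) (fracs y)" "sat x (Less s t)" for x y
    proof -
      have "sgn (tm_val y t - tm_val y s) = 1" using A(3)[OF that(1,2)] that(3) by simp
      then show ?thesis by (simp add: sgn_1_pos)
    qed
    then show ?case using A(1,2) by (intro exI[of _ A] conjI allI impI)
  next
    case (IsInt t)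
    obtain A where A: "finite A" "A \<subseteq> rat_affine" "\<And>x y. floors x = floors y \<Longrightarrow>
      agree A (fracs x) (fracs y) \<Longrightarrow> sgn (tm_val x t) = sgn (tm_val y t) \<and>
      (tm_val x t \<in> \<int> \<longleftrightarrow> tm_val y t \<in> \<int>)"
      by (rule integral_affine_fracs[OF tm_val_affine[of t] tm_val_Ints]) (assumption | rule that)+
    have "sat y (IsInt t)"
      if "floors x = floors y" "agree A (fracs x) (fracs y)" "sat x (IsInt t)" for x y
      using A(3)[OF that(1,2)] that(3) by simp
    then show ?case using A(1,2) by (intro exI[of _ A] conjI allI impI)
  next
    case (Neg p)
    then obtain A where A: "finite A" "A \<subseteq> rat_affine"
      "\<forall>x y. floors x = floors y \<longrightarrow> agree A (fracs x) (fracs y) \<longrightarrow> sat x p \<longrightarrow> sat y p"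
      by (elim exE conjE)
    have "sat y (Neg p)" if "floors x = floors y" "agree A (fracs x) (fracs y)" "sat x (Neg p)" for x y
      using A(3)[rule_format, OF that(1)[symmetric] agree_sym[OF that(2)]] that(3) by auto
    then show ?case using A(1,2) by (intro exI[of _ A] conjI allI impI)
  next
    case (Conj p q)
    obtain A where A: "finite A" "A \<subseteq> rat_affine"
      "\<forall>x y. floors x = floors y \<longrightarrow> agree A (fracs x) (fracs y) \<longrightarrow> sat x p \<longrightarrow> sat y p"
      using Conj.IH(1) by (elim exE conjE)
    obtain B where B: "finite B" "B \<subseteq> rat_affine"
      "\<forall>x y. floors x = floors y \<longrightarrow> agree B (fracs x) (fracs y) \<longrightarrow> sat x q \<longrightarrow> sat y q"
      using Conj.IH(2) by (elim exE conjE)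
    have "sat y (Conj p q)"
      if "floors x = floors y" "agree (A \<union> B) (fracs x) (fracs y)" "sat x (Conj p q)" for x y
      using that A(3)[rule_format, of x y] B(3)[rule_format, of x y] by (simp add: agree_Un)
    moreover have "finite (A \<union> B)" "A \<union> B \<subseteq> rat_affine" using A(1,2) B(1,2) by auto
    ultimately show ?case by (intro exI[of _ "A \<union> B"] conjI allI impI)
  next
    case (Exists k p)
    then obtain A where A: "finite A" "A \<subseteq> rat_affine"
      "\<forall>x y. floors x = floors y \<longrightarrow> agree A (fracs x) (fracs y) \<longrightarrow> sat x p \<longrightarrow> sat y p"
      by (elim exE conjE)
    \<comment> \<open>The two added functions force the new value of the k-th coordinate into [0,
      1), so that it is again a fractional part.\<close>
    define C where "C = insert (\<lambda>x. x k) (insert (\<lambda>x. x k - 1) A)"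
    have C: "finite C" "C \<subseteq> rat_affine"
      using A rat_affine.coord[of k] rat_affine_diff[OF rat_affine.coord[of k] rat_affine.const[of 1]]
      by (auto simp: C_def)
    obtain B where B: "finite B" "B \<subseteq> rat_affine"
      "\<And>x y t. agree B x y \<Longrightarrow>
        \<exists>t'. agree C (x(k := t)) (y(k := t')) \<and> ((\<forall>i. y i \<in> \<rat>) \<longrightarrow> t' \<in> \<rat>)"
      using eliminate_variable[OF C, of k] by blast
    have "sat y (Exists k p)"
      if fl: "floors x = floors y" and ag: "agree B (fracs x) (fracs y)" and sat: "sat x (Exists k p)" for x y
    proof -
      obtain a where a: "sat (x(k := a)) p" using sat by auto
      obtain t where t: "agree C ((fracs x)(k := frac a)) ((fracs y)(k := t))"
        using B(3)[OF ag, of "frac a"] by (elim exE conjE)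
      have "sgn (frac a) = sgn t" "sgn (frac a - 1) = sgn (t - 1)"
        using t by (simp_all add: C_def agree_insert)
      then have t01: "0 \<le> t" "t < 1"
        using frac_ge_0[of a] frac_lt_1[of a] by (auto simp: sgn_if split: if_splits)
      define b where "b = of_int \<lfloor>a\<rfloor> + t"
      have b: "\<lfloor>b\<rfloor> = \<lfloor>a\<rfloor>" "frac b = t"
        using t01 by (simp_all add: b_def frac_def floor_eq_iff)
      have "fracs (x(k := a)) = (fracs x)(k := frac a)" "fracs (y(k := b)) = (fracs y)(k := t)"
        using b by (auto simp: fun_eq_iff)
      then have "agree A (fracs (x(k := a))) (fracs (y(k := b)))"
        using t by (simp add: C_def agree_insert)
      moreover have "floors (x(k := a)) = floors (y(k := b))"
        using fl b by (auto simp: fun_eq_iff)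
      ultimately have "sat (y(k := b)) p" using A(3) a by meson
      then show ?thesis by auto
    qed
    then show ?case using B(1,2) by (intro exI[of _ B] conjI allI impI)
  qed
  then obtain A where A: "finite A" "A \<subseteq> rat_affine"
    "\<forall>x y. floors x = floors y \<longrightarrow> agree A (fracs x) (fracs y) \<longrightarrow> sat x p \<longrightarrow> sat y p"
    by (elim exE conjE)
  show ?thesis
  proof
    show "sat x p \<longleftrightarrow> sat y p" if "floors x = floors y" "agree A (fracs x) (fracs y)" for x y
      using A(3)[rule_format, OF that]
        A(3)[rule_format, OF that(1)[symmetric] agree_sym[OF that(2)]] by blast
  qed fact+
qed

definition small :: "real \<Rightarrow> (nat \<Rightarrow> real) \<Rightarrow> bool" where
  "small r w \<longleftrightarrow> (\<forall>i. \<bar>w i\<bar> < r)"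

text \<open>From a non-integer a short enough step reaches no integer; from an integer only a
  downward step changes the floor, and by exactly 1.\<close>

lemma eventually_floor_add_small:
  fixes x :: real
  shows "\<forall>\<^sub>F r in at_right 0. \<forall>h. \<bar>h\<bar> < r \<longrightarrow>
    \<lfloor>x + h\<rfloor> = \<lfloor>x\<rfloor> - (if frac x = 0 \<and> h < 0 then 1 else 0)"
proof (cases "frac x = 0")
  case True
  then have x: "x = of_int \<lfloor>x\<rfloor>" by (simp add: frac_def)
  have "\<forall>h. \<bar>h\<bar> < r \<longrightarrow> \<lfloor>x + h\<rfloor> = \<lfloor>x\<rfloor> - (if frac x = 0 \<and> h < 0 then 1 else 0)"
    if "r < 1" for r
    using that True x by (auto simp: floor_eq_iff)
  then show ?thesis unfolding eventually_at_right_field by (intro exI[of _ 1]) auto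
next
  case False
  then have pos: "min (frac x) (1 - frac x) > 0" using frac_ge_0[of x] frac_lt_1[of x] by simp
  have "\<forall>h. \<bar>h\<bar> < r \<longrightarrow> \<lfloor>x + h\<rfloor> = \<lfloor>x\<rfloor> - (if frac x = 0 \<and> h < 0 then 1 else 0)"
    if "r < min (frac x) (1 - frac x)" for r
    using that False by (auto simp: floor_eq_iff frac_def)
  then show ?thesis unfolding eventually_at_right_field using pos by blast
qed

text \<open>If \<open>c\<close> is nonzero, so is \<open>c'\<close>, and short vectors have linear
  parts too small to change either sign. If both are 0, the linear parts alone decide.\<close>

lemma eventually_sgn_add_small:
  assumes "f \<in> rat_affine" "sgn c = sgn c'"
  shows "\<forall>\<^sub>F r in at_right 0. \<forall>w w'. small r w \<longrightarrow> small r w' \<longrightarrow>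
    sgn (f w - f (\<lambda>_. 0)) = sgn (f w' - f (\<lambda>_. 0)) \<longrightarrow>
    sgn (c + (f w - f (\<lambda>_. 0))) = sgn (c' + (f w' - f (\<lambda>_. 0)))"
proof (cases "c = 0")
  case True
  then show ?thesis using assms(2) by (simp add: sgn_zero_iff)
next
  case False
  then have "c' \<noteq> 0" using assms(2) by (auto simp: sgn_zero_iff)
  obtain K where "K \<ge> 0" and K: "\<forall>r\<ge>0. \<forall>w. (\<forall>i. \<bar>w i\<bar> \<le> r) \<longrightarrow> \<bar>f w - f (\<lambda>_. 0)\<bar> \<le> K * r"
    using rat_affine_bounded[OF assms(1)] by (elim exE conjE)
  have "((\<lambda>r. K * r) \<longlongrightarrow> K * 0) (at_right 0)" by (intro tendsto_intros)
  moreover have "min \<bar>c\<bar> \<bar>c'\<bar> > 0" using False \<open>c' \<noteq> 0\<close> by simp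
  ultimately have "\<forall>\<^sub>F r in at_right 0. K * r < min \<bar>c\<bar> \<bar>c'\<bar>"
    using order_tendstoD(2) by fastforce
  moreover have "\<forall>\<^sub>F r in at_right (0::real). r > 0" by (simp add: eventually_at_right_less)
  ultimately show ?thesis
  proof eventually_elim
    case (elim r)
    have *: "\<bar>f w - f (\<lambda>_. 0)\<bar> < min \<bar>c\<bar> \<bar>c'\<bar>" if "small r w" for w
      using K[rule_format, of r w] that elim by (auto simp: small_def less_imp_le)
    have "sgn (c + (f w - f (\<lambda>_. 0))) = sgn (c' + (f w' - f (\<lambda>_. 0)))" if "small r w" "small r w'" for w w'
      using *[OF that(1)] *[OF that(2)] assms(2) by (auto simp: sgn_if split: if_splits)
    then show ?case by blast
  qed
qed

section \<open>Local structure and tangent cones\<close>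

lemma move_Rn [simp]: "x \<in> Rn n \<Longrightarrow> w \<in> Rn n \<Longrightarrow> move x t w \<in> Rn n"
  by (simp add: Rn_iff move_def)

lemma move_move: "move (move x s v) t v = move x (s + t) v"
  by (simp add: move_def fun_eq_iff algebra_simps)

lemma move_0 [simp]: "move x 0 v = x"
  by (simp add: move_def)

lemma move_scale: "move x t (\<lambda>i. c * w i) = move x (t * c) w"
  by (simp add: move_def mult.assoc)

lemma move_nested: "move x t (move w \<alpha> v) = move (move x t w) (t * \<alpha>) v"
  by (simp add: move_def fun_eq_iff algebra_simps)

lemma zero_Rn [simp]: "(\<lambda>_. 0) \<in> Rn n"
  by (simp add: Rn_iff)

lemma scale_Rn [simp]: "w \<in> Rn n \<Longrightarrow> (\<lambda>i. c * w i) \<in> Rn n"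
  by (simp add: Rn_iff)

lemma diff_Rn [simp]: "x \<in> Rn n \<Longrightarrow> y \<in> Rn n \<Longrightarrow> (\<lambda>i. x i - y i) \<in> Rn n"
  by (simp add: Rn_iff)

lemma minus_Rn [simp]: "x \<in> Rn n \<Longrightarrow> (\<lambda>i. - x i) \<in> Rn n"
  by (simp add: Rn_iff)

lemma rat_affine_shift:
  assumes "f \<in> rat_affine" "\<And>i. w i \<in> \<rat>"
  shows "(\<lambda>x. f (move x 1 w)) \<in> rat_affine"
proof (rule rat_affine_comp[OF assms(1), where M = "\<lambda>x. move x 1 w"])
  show "(\<lambda>x. move x 1 w k) \<in> rat_affine" for k
    using rat_affine.add[OF rat_affine.coord[of k] rat_affine.const[OF assms(2)[of k]]]
    by (simp add: move_def)
qed

lemma rat_affine_linear_part: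
  assumes "f \<in> rat_affine"
  shows "(\<lambda>w. f w - f (\<lambda>_. 0)) \<in> rat_affine"
proof -
  have "f (\<lambda>_. 0) \<in> \<rat>" by (rule rat_affine_Rats[OF assms]) simp
  then show ?thesis using rat_affine_diff[OF assms rat_affine.const] by simp
qed

text \<open>\<open>L\<close> does not depend on the point. The case \<open>y = x\<close> shows that
  each tangent cone is a union of cells of \<open>L\<close>, hence that there are finitely many
  cones; the case of distinct points carries a cone from one point to another whose fractional parts
  lie in the same cell of \<open>B\<close>.\<close>

lemma RZ_definable_local_pattern:
  assumes "RZ_definable n X"
  obtains B L where "finite B" "B \<subseteq> rat_affine" "finite L" "L \<subseteq> rat_affine"
    "\<And>f. f \<in> L \<Longrightarrow> f (\<lambda>_. 0) = 0"
    "\<And>x y. x \<in> Rn n \<Longrightarrow> y \<in> Rn n \<Longrightarrow> floors x = floors y \<Longrightarrow> agree B (fracs x) (fracs y) \<Longrightarrow>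
      \<exists>r>0. \<forall>w\<in>Rn n. \<forall>w'\<in>Rn n. small r w \<longrightarrow> small r w' \<longrightarrow> agree L w w' \<longrightarrow>
        (move x 1 w \<in> X \<longleftrightarrow> move y 1 w' \<in> X)"
proof -
  obtain p where X: "X = {x \<in> Rn n. sat x p}"
    using assms unfolding definable_def by blast
  obtain A where A: "finite A" "A \<subseteq> rat_affine"
    "\<And>x y. floors x = floors y \<Longrightarrow> agree A (fracs x) (fracs y) \<Longrightarrow> sat x p \<longleftrightarrow> sat y p"
    by (rule sat_floors_fracs[of p]) (rule that)
  \<comment> \<open>If the floors at the coordinates in \<open>J\<close> drop by 1 under a short
    step w, the corresponding fractional parts gain 1. Hence a function \<open>a\<close> at the new
    fractional parts is \<open>g a J\<close> at the old ones plus its linear part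
    \<open>lp a\<close> at w.\<close>
  define ind :: "nat set \<Rightarrow> nat \<Rightarrow> real" where "ind J = (\<lambda>i. if i \<in> J then 1 else 0)" for J
  \<comment> \<open>The coordinate functions tell, as members of \<open>B\<close>, which fractional
    parts vanish and, as members of \<open>L\<close>, which steps are negative; together this
    determines \<open>J\<close>.\<close>
  define C :: "((nat \<Rightarrow> real) \<Rightarrow> real) set" where "C = (\<lambda>i x. x i) ` {..<n}"
  define g where "g a J = (\<lambda>x. a (move x 1 (ind J)))" for a :: "(nat \<Rightarrow> real) \<Rightarrow> real" and J
  define lp where "lp a = (\<lambda>w. a w - a (\<lambda>_. 0))" for a :: "(nat \<Rightarrow> real) \<Rightarrow> real"
  define B where "B = C \<union> (\<lambda>p. g (fst p) (snd p)) ` (A \<times> Pow {..<n})"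
  define L where "L = C \<union> lp ` A"
  have C: "finite C" "C \<subseteq> rat_affine"
    using rat_affine.coord by (auto simp: C_def)
  have g: "g a J \<in> rat_affine" if "a \<in> A" for a J
    unfolding g_def using that A(2) by (intro rat_affine_shift) (auto simp: ind_def)
  have lp: "lp a \<in> rat_affine" if "a \<in> A" for a
    unfolding lp_def using that A(2) by (intro rat_affine_linear_part) auto
  have coordC: "sgn (x i) = sgn (y i)" if "agree C x y" "i < n" for x y i
    using that unfolding agree_def C_def by auto
  show ?thesis
  proof
    show "finite B" "finite L" using C A(1) by (simp_all add: B_def L_def)
    show "B \<subseteq> rat_affine" using C(2) g by (auto simp: B_def)
    show "L \<subseteq> rat_affine" using C(2) lp by (auto simp: L_def)
    show "f (\<lambda>_. 0) = 0" if "f \<in> L" for f using that by (auto simp: L_def C_def lp_def)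
    fix x y assume x: "x \<in> Rn n" and y: "y \<in> Rn n" and fl: "floors x = floors y"
      and ag: "agree B (fracs x) (fracs y)"
    have agC: "agree C (fracs x) (fracs y)" using ag unfolding B_def agree_Un by simp
    have agg: "sgn (g a J (fracs x)) = sgn (g a J (fracs y))" if "a \<in> A" "J \<subseteq> {..<n}" for a J
    proof -
      have "g a J \<in> (\<lambda>p. g (fst p) (snd p)) ` (A \<times> Pow {..<n})"
        using that by (intro image_eqI[of _ _ "(a, J)"]) auto
      then show ?thesis using ag unfolding B_def agree_def by simp
    qed
    define Fl where "Fl z r i \<longleftrightarrow> (\<forall>h. \<bar>h\<bar> < r \<longrightarrow>
      \<lfloor>z i + h\<rfloor> = \<lfloor>z i\<rfloor> - (if frac (z i) = 0 \<and> h < 0 then 1 else 0))" for z :: "nat \<Rightarrow> real" and r i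
    define Sg where "Sg r a J \<longleftrightarrow> (\<forall>w w'. small r w \<longrightarrow> small r w' \<longrightarrow>
      sgn (lp a w) = sgn (lp a w') \<longrightarrow>
      sgn (g a J (fracs x) + lp a w) = sgn (g a J (fracs y) + lp a w'))" for r a J
    have "\<forall>\<^sub>F r in at_right 0. \<forall>i\<in>{..<n}. Fl x r i"
      unfolding Fl_def by (intro eventually_ball_finite ballI eventually_floor_add_small) simp
    moreover have "\<forall>\<^sub>F r in at_right 0. \<forall>i\<in>{..<n}. Fl y r i"
      unfolding Fl_def by (intro eventually_ball_finite ballI eventually_floor_add_small) simp
    moreover have "\<forall>\<^sub>F r in at_right 0. \<forall>p\<in>A \<times> Pow {..<n}. Sg r (fst p) (snd p)"
    proof (intro eventually_ball_finite ballI)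
      fix p assume "p \<in> A \<times> Pow {..<n}"
      then have p: "fst p \<in> A" "snd p \<subseteq> {..<n}" by auto
      then have "fst p \<in> rat_affine" using A(2) by auto
      from eventually_sgn_add_small[OF this agg[OF p]]
      show "\<forall>\<^sub>F r in at_right 0. Sg r (fst p) (snd p)" unfolding Sg_def lp_def .
    qed (use A(1) in simp)
    moreover have "\<forall>\<^sub>F r in at_right (0::real). r > 0" by (simp add: eventually_at_right_less)
    ultimately have "\<forall>\<^sub>F r in at_right 0. r > 0 \<and> (\<forall>i\<in>{..<n}. Fl x r i) \<and> (\<forall>i\<in>{..<n}. Fl y r i) \<and>
      (\<forall>p\<in>A \<times> Pow {..<n}. Sg r (fst p) (snd p))"
      by eventually_elim blast
    then obtain r where r: "r > 0" "\<forall>i\<in>{..<n}. Fl x r i" "\<forall>i\<in>{..<n}. Fl y r i"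
      "\<forall>p\<in>A \<times> Pow {..<n}. Sg r (fst p) (snd p)"
      using eventually_happens'[OF trivial_limit_at_right_real] by blast
    have fl_move: "\<lfloor>move z 1 u i\<rfloor> = \<lfloor>z i\<rfloor> - (if i < n \<and> frac (z i) = 0 \<and> u i < 0 then 1 else 0)"
      if "z \<in> Rn n" "u \<in> Rn n" "small r u" "\<forall>i\<in>{..<n}. Fl z r i" for z u i
    proof (cases "i < n")
      case True
      then show ?thesis using that unfolding Fl_def small_def move_def by simp
    next
      case False
      then show ?thesis using that(1,2) by (simp add: Rn_iff move_def)
    qed
    have frac_move: "fracs (move z 1 u) = move (move (fracs z) 1 (ind J)) 1 u"
      if "z \<in> Rn n" "u \<in> Rn n" "small r u" "\<forall>i\<in>{..<n}. Fl z r i"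
        and J: "J = {i. i < n \<and> frac (z i) = 0 \<and> u i < 0}" for z u J
    proof
      fix i
      have "frac (move z 1 u i) = z i + u i - of_int \<lfloor>move z 1 u i\<rfloor>" by (simp add: frac_def move_def)
      also have "\<dots> = move (move (fracs z) 1 (ind J)) 1 u i"
        unfolding fl_move[OF that(1-4)] by (auto simp: J ind_def move_def frac_def)
      finally show "frac (move z 1 u i) = move (move (fracs z) 1 (ind J)) 1 u i" .
    qed
    have "move x 1 w \<in> X \<longleftrightarrow> move y 1 w' \<in> X"
      if w: "w \<in> Rn n" "w' \<in> Rn n" "small r w" "small r w'" "agree L w w'" for w w'
    proof -
      define J where "J = {i. i < n \<and> frac (x i) = 0 \<and> w i < 0}"
      have "w i < 0 \<longleftrightarrow> w' i < 0" if "i < n" for i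
        using coordC[of w w' i] that w(5) unfolding L_def agree_Un by (auto simp: sgn_if split: if_splits)
      moreover have "frac (x i) = 0 \<longleftrightarrow> frac (y i) = 0" if "i < n" for i
        using coordC[OF agC that] by (metis sgn_zero_iff)
      ultimately have J': "J = {i. i < n \<and> frac (y i) = 0 \<and> w' i < 0}" unfolding J_def by blast
      then have J'': "(i < n \<and> frac (x i) = 0 \<and> w i < 0) = (i < n \<and> frac (y i) = 0 \<and> w' i < 0)" for i
        unfolding J_def by blast
      have fl': "floors (move x 1 w) = floors (move y 1 w')"
        unfolding fl_move[OF x w(1,3) r(2)] fl_move[OF y w(2,4) r(3)] J''
        using fl by (simp add: fun_eq_iff)
      have "agree A (fracs (move x 1 w)) (fracs (move y 1 w'))"
        unfolding frac_move[OF x w(1,3) r(2) J_def] frac_move[OF y w(2,4) r(3) J'] agree_def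
      proof
        fix a assume a: "a \<in> A"
        then have af: "a \<in> rat_affine" using A(2) by auto
        have eq: "a (move (move z 1 (ind J)) 1 u) = g a J z + lp a u" for z u
          by (simp add: g_def lp_def rat_affine_move[OF af, of _ 1 u])
        have "J \<subseteq> {..<n}" by (auto simp: J_def)
        then have "Sg r a J" using bspec[OF r(4), of "(a, J)"] a by simp
        moreover have "sgn (lp a w) = sgn (lp a w')"
          using w(5) a unfolding L_def agree_def by simp
        ultimately show "sgn (a (move (move (fracs x) 1 (ind J)) 1 w)) =
          sgn (a (move (move (fracs y) 1 (ind J)) 1 w'))"
          unfolding eq Sg_def using w by blast
      qed
      then have "sat (move x 1 w) p \<longleftrightarrow> sat (move y 1 w') p" by (rule A(3)[OF fl'])
      then show ?thesis using x y w by (simp add: X)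
    qed
    then show "\<exists>r>0. \<forall>w\<in>Rn n. \<forall>w'\<in>Rn n. small r w \<longrightarrow> small r w' \<longrightarrow> agree L w w' \<longrightarrow>
        (move x 1 w \<in> X \<longleftrightarrow> move y 1 w' \<in> X)"
      using r(1) by blast
  qed
qed

lemma eventually_small_move:
  assumes "w \<in> Rn n" "u \<in> Rn n" "small r w"
  shows "\<forall>\<^sub>F t in at_right 0. small r (move w t u)"
proof -
  have "\<forall>\<^sub>F t in at_right 0. \<bar>w i + t * u i\<bar> < r" for i
  proof (rule order_tendstoD(2))
    show "((\<lambda>t. \<bar>w i + t * u i\<bar>) \<longlongrightarrow> \<bar>w i + 0 * u i\<bar>) (at_right 0)" by (intro tendsto_intros)
    show "\<bar>w i + 0 * u i\<bar> < r" using assms(3) by (simp add: small_def)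
  qed
  then have "\<forall>\<^sub>F t in at_right 0. \<forall>i\<in>{..<n}. \<bar>w i + t * u i\<bar> < r"
    by (intro eventually_ball_finite ballI) auto
  then show ?thesis
  proof eventually_elim
    case (elim t)
    have "0 < r" using assms(3) abs_ge_zero[of "w 0"] unfolding small_def by (meson le_less_trans)
    have "\<bar>w i + t * u i\<bar> < r" for i
    proof (cases "i < n")
      case False
      then show ?thesis using assms(1,2) \<open>0 < r\<close> by (simp add: Rn_iff)
    qed (use elim in simp)
    then show ?case by (simp add: small_def move_def)
  qed
qed

lemma small_zero [simp]: "small r (\<lambda>_. 0) \<longleftrightarrow> r > 0"
  by (simp add: small_def)

lemma eventually_small_scale:
  assumes "u \<in> Rn n" "r > 0"
  shows "\<forall>\<^sub>F t in at_right 0. small r (\<lambda>i. t * u i)"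
  using eventually_small_move[of "\<lambda>_. 0" n u r] assms by (simp add: move_def)

text \<open>This cone need not be closed: it collects the directions in which a short segment,
  without its endpoint \<open>x\<close>, stays in \<open>X\<close>. At the null direction it records
  whether \<open>x\<close> itself is in \<open>X\<close>, so the cones determine
  \<open>X\<close>.\<close>

definition tangent_cone :: "nat \<Rightarrow> (nat \<Rightarrow> real) set \<Rightarrow> (nat \<Rightarrow> real) \<Rightarrow> (nat \<Rightarrow> real) set" where
  "tangent_cone n X x = {w \<in> Rn n. \<forall>\<^sub>F t in at_right 0. move x t w \<in> X}"

definition lin :: "nat \<Rightarrow> (nat \<Rightarrow> real) set \<Rightarrow> (nat \<Rightarrow> real) set" where
  "lin n D = {v \<in> Rn n. \<forall>w\<in>D. \<forall>\<alpha>. move w \<alpha> v \<in> D}"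

lemma tangent_cone_Rn: "tangent_cone n X x \<subseteq> Rn n"
  by (auto simp: tangent_cone_def)

definition conic_on :: "nat \<Rightarrow> (nat \<Rightarrow> real) set \<Rightarrow> (nat \<Rightarrow> real) \<Rightarrow> real \<Rightarrow> bool" where
  "conic_on n X x r \<longleftrightarrow> r > 0 \<and> (\<forall>w\<in>Rn n. small r w \<longrightarrow> (move x 1 w \<in> X \<longleftrightarrow> w \<in> tangent_cone n X x))"

lemma tangent_cone_scale:
  assumes "w \<in> tangent_cone n X x" "t > 0"
  shows "(\<lambda>i. t * w i) \<in> tangent_cone n X x"
proof -
  have "\<forall>\<^sub>F s in at_right 0. move x s w \<in> X" using assms(1) by (simp add: tangent_cone_def)
  then obtain b where "b > 0" and b: "\<And>s. 0 < s \<Longrightarrow> s < b \<Longrightarrow> move x s w \<in> X"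
    unfolding eventually_at_right_field by blast
  have "move x s (\<lambda>i. t * w i) \<in> X" if "0 < s" "s < b / t" for s
    unfolding move_scale using that assms(2) by (intro b) (auto simp: field_simps)
  then have "\<forall>\<^sub>F s in at_right 0. move x s (\<lambda>i. t * w i) \<in> X"
    unfolding eventually_at_right_field using \<open>b > 0\<close> assms(2) by (intro exI[of _ "b / t"]) auto
  then show ?thesis using assms(1) by (simp add: tangent_cone_def)
qed

lemma tangent_cone_scale_iff:
  assumes "t > 0" "w \<in> Rn n"
  shows "(\<lambda>i. t * w i) \<in> tangent_cone n X x \<longleftrightarrow> w \<in> tangent_cone n X x"
proof
  assume "(\<lambda>i. t * w i) \<in> tangent_cone n X x"
  from tangent_cone_scale[OF this, of "1 / t"] show "w \<in> tangent_cone n X x" using assms by simp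
qed (rule tangent_cone_scale[OF _ assms(1)])

lemma tangent_cone_eqI:
  assumes "\<And>u. u \<in> Rn n \<Longrightarrow> \<forall>\<^sub>F t in at_right 0. move x t u \<in> X \<longleftrightarrow> move y t u \<in> Y"
  shows "tangent_cone n X x = tangent_cone n Y y"
proof -
  have "(\<forall>\<^sub>F t in at_right 0. move x t u \<in> X) \<longleftrightarrow> (\<forall>\<^sub>F t in at_right 0. move y t u \<in> Y)"
    if "u \<in> Rn n" for u
    using assms[OF that] by (rule eventually_subst)
  then show ?thesis by (auto simp: tangent_cone_def)
qed

text \<open>\<open>X\<close> translated by -x and the cone at \<open>x\<close> coincide on a
  neighbourhood of \<open>w\<close>, and a tangent cone depends only on the germ of the set.\<close>

lemma tangent_cone_move_small:
  assumes "conic_on n X x r" "w \<in> Rn n" "small r w"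
  shows "tangent_cone n X (move x 1 w) = tangent_cone n (tangent_cone n X x) w"
proof (rule tangent_cone_eqI)
  fix u assume u: "u \<in> Rn n"
  have "\<forall>\<^sub>F t in at_right 0. small r (move w t u)" by (rule eventually_small_move) fact+
  then show "\<forall>\<^sub>F t in at_right 0. (move (move x 1 w) t u \<in> X) = (move w t u \<in> tangent_cone n X x)"
  proof eventually_elim
    case (elim t)
    have "move (move x 1 w) t u = move x 1 (move w t u)" by (simp add: move_def add.assoc)
    then show ?case using assms(1,2) elim u by (simp add: conic_on_def)
  qed
qed

lemma tangent_cone_cone_scale:
  assumes "t > 0" "w \<in> Rn n"
  shows "tangent_cone n (tangent_cone n X x) (\<lambda>i. t * w i) = tangent_cone n (tangent_cone n X x) w"
proof -
  have "tangent_cone n (tangent_cone n X x) (\<lambda>i. t * w i) \<subseteq> tangent_cone n (tangent_cone n X x) w"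
    if t: "t > 0" and w: "w \<in> Rn n" for t w
  proof
    fix u assume u: "u \<in> tangent_cone n (tangent_cone n X x) (\<lambda>i. t * w i)"
    have uR: "u \<in> Rn n" using u tangent_cone_Rn by blast
    have "(\<lambda>i. t * u i) \<in> tangent_cone n (tangent_cone n X x) (\<lambda>i. t * w i)" by (rule tangent_cone_scale[OF u t])
    then have "\<forall>\<^sub>F s in at_right 0. move (\<lambda>i. t * w i) s (\<lambda>i. t * u i) \<in> tangent_cone n X x"
      by (simp add: tangent_cone_def)
    then have "\<forall>\<^sub>F s in at_right 0. move w s u \<in> tangent_cone n X x"
    proof eventually_elim
      case (elim s)
      have "move (\<lambda>i. t * w i) s (\<lambda>i. t * u i) = (\<lambda>i. t * move w s u i)"
        by (simp add: move_def algebra_simps)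
      then show ?case using elim tangent_cone_scale_iff[OF t, of "move w s u" n X x] w uR by simp
    qed
    then show "u \<in> tangent_cone n (tangent_cone n X x) w" using u by (simp add: tangent_cone_def)
  qed
  from this[OF assms] this[of "1 / t" "\<lambda>i. t * w i"] assms show ?thesis by auto
qed

text \<open>Near \<open>x\<close> the cone at x + h v is that of the cone at h v, and conicity
  removes the factor h. So the tangent cone is constant on a short open segment issuing from
  \<open>x\<close>; this is the one-sided limit used in the arguments along lines.\<close>

lemma eventually_tangent_cone_move:
  assumes "conic_on n X x r" "v \<in> Rn n"
  shows "\<forall>\<^sub>F h in at_right 0. tangent_cone n X (move x h v) = tangent_cone n (tangent_cone n X x) v"
proof -
  have "\<forall>\<^sub>F h in at_right 0. small r (\<lambda>i. h * v i)"
    using assms by (intro eventually_small_scale) (auto simp: conic_on_def)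
  moreover have "\<forall>\<^sub>F h in at_right (0::real). h > 0" by (simp add: eventually_at_right_less)
  ultimately show ?thesis
  proof eventually_elim
    case (elim h)
    have "tangent_cone n X (move x h v) = tangent_cone n X (move x 1 (\<lambda>i. h * v i))" by (simp add: move_scale)
    also have "\<dots> = tangent_cone n (tangent_cone n X x) (\<lambda>i. h * v i)"
      using assms elim by (intro tangent_cone_move_small) auto
    also have "\<dots> = tangent_cone n (tangent_cone n X x) v" using assms elim by (intro tangent_cone_cone_scale) auto
    finally show ?case .
  qed
qed

text \<open>A translation that preserves \<open>D\<close> carries the points w + t u to the points w
  + t (u + \<alpha> v) of the same set, so invariance passes to the cone.\<close>

lemma lin_cone_mono: "lin n D \<subseteq> lin n (tangent_cone n D w)"
proof
  fix v assume v: "v \<in> lin n D"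
  have "move u \<alpha> v \<in> tangent_cone n D w" if u: "u \<in> tangent_cone n D w" for u \<alpha>
  proof -
    have "\<forall>\<^sub>F t in at_right 0. move w t u \<in> D" using u by (simp add: tangent_cone_def)
    then have "\<forall>\<^sub>F t in at_right 0. move w t (move u \<alpha> v) \<in> D"
      by eventually_elim (use v in \<open>simp add: move_nested lin_def\<close>)
    then show ?thesis using u v by (simp add: tangent_cone_def lin_def)
  qed
  then show "v \<in> lin n (tangent_cone n D w)" using v by (simp add: lin_def)
qed

lemma lin_scale: "v \<in> lin n D \<Longrightarrow> (\<lambda>i. c * v i) \<in> lin n D"
  by (simp add: lin_def move_scale)

lemma lin_minus: "v \<in> lin n D \<Longrightarrow> (\<lambda>i. - v i) \<in> lin n D"
  using lin_scale[of v n D "-1"] by simp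

lemma move_lin_iff:
  assumes "v \<in> lin n D"
  shows "move w \<alpha> v \<in> D \<longleftrightarrow> w \<in> D"
proof
  assume "move w \<alpha> v \<in> D"
  then have "move (move w \<alpha> v) (- \<alpha>) v \<in> D" using assms by (simp add: lin_def)
  then show "w \<in> D" by (simp add: move_move)
qed (use assms in \<open>simp add: lin_def\<close>)

text \<open>For a lineality direction v, membership of v + t u in the cone amounts to that of t u,
  hence to that of u: at v the cone looks as it does at 0.\<close>

lemma tangent_cone_cone_lin:
  assumes "v \<in> lin n (tangent_cone n X x)"
  shows "tangent_cone n (tangent_cone n X x) v = tangent_cone n X x"
proof -
  have v: "v \<in> Rn n" using assms by (simp add: lin_def)
  have "move v t u \<in> tangent_cone n X x \<longleftrightarrow> u \<in> tangent_cone n X x" if "t > 0" "u \<in> Rn n" for t u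
  proof -
    have "move v t u = move (\<lambda>i. t * u i) 1 v" by (simp add: move_def add.commute)
    then show ?thesis using move_lin_iff[OF assms] tangent_cone_scale_iff that by metis
  qed
  then have *: "\<forall>\<^sub>F t in at_right 0. (move v t u \<in> tangent_cone n X x) = (u \<in> tangent_cone n X x)"
    if "u \<in> Rn n" for u
    using that unfolding eventually_at_right_field by (intro exI[of _ 1]) auto
  have "u \<in> tangent_cone n (tangent_cone n X x) v \<longleftrightarrow> u \<in> tangent_cone n X x" if u: "u \<in> Rn n" for u
    using eventually_subst[OF *[OF u]] u
    by (simp add: tangent_cone_def[of n "tangent_cone n X x"] eventually_const_iff)
  then show ?thesis using tangent_cone_Rn by blast
qed

lemma zero_lin [simp]: "(\<lambda>_. 0) \<in> lin n D"
  by (simp add: lin_def move_def)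

lemma mem_cone_zero:
  assumes "conic_on n X x r"
  shows "(\<lambda>_. 0) \<in> tangent_cone n X x \<longleftrightarrow> x \<in> X"
  using assms by (simp add: tangent_cone_def move_def eventually_const_iff)

section \<open>Sign vectors and constancy of cones on cells\<close>

definition signs :: "((nat \<Rightarrow> real) \<Rightarrow> real) set \<Rightarrow> (nat \<Rightarrow> real) \<Rightarrow> ((nat \<Rightarrow> real) \<Rightarrow> real) \<Rightarrow> real" where
  "signs A x = restrict (\<lambda>a. sgn (a x)) A"

lemma signs_eqD:
  assumes "signs A x = signs A y"
  shows "agree A x y"
proof -
  have "sgn (a x) = sgn (a y)" if "a \<in> A" for a
    using fun_cong[OF assms, of a] that by (simp add: signs_def)
  then show ?thesis by (simp add: agree_def)
qed

lemma finite_signs: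
  assumes "finite A"
  shows "finite (signs A ` U)"
proof (rule finite_subset)
  have "sgn c \<in> {-1, 0, 1}" for c :: real by (simp add: sgn_if)
  then show "signs A ` U \<subseteq> A \<rightarrow>\<^sub>E {-1, 0, 1}"
    unfolding signs_def by (intro image_subsetI restrict_PiE_iff[THEN iffD2] ballI)
  show "finite (A \<rightarrow>\<^sub>E {-1, 0, 1 :: real})" using assms by (intro finite_PiE) auto
qed

text \<open>A set closed under agreement is determined by the sign vectors of its points, and only
  finitely many sign vectors exist.\<close>

lemma finite_agree_closed:
  assumes "finite L"
  shows "finite {C. C \<subseteq> U \<and> (\<forall>x\<in>C. \<forall>y\<in>U. agree L x y \<longrightarrow> y \<in> C)}" (is "finite ?F")
proof -
  let ?s = "signs L"
  have "(\<lambda>C. ?s ` C) ` ?F \<subseteq> Pow (?s ` UNIV)" by blast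
  then have "finite ((\<lambda>C. ?s ` C) ` ?F)"
    using finite_signs[OF assms] by (meson finite_Pow_iff finite_subset)
  moreover have "inj_on (\<lambda>C. ?s ` C) ?F"
  proof (rule inj_onI)
    have *: "C \<subseteq> D" if CD: "C \<in> ?F" "D \<in> ?F" "?s ` C = ?s ` D" for C D
    proof
      fix x assume x: "x \<in> C"
      then have "?s x \<in> ?s ` D" using CD(3) by blast
      then obtain y where y: "y \<in> D" "?s y = ?s x" by auto
      moreover have "x \<in> U" using x CD(1) by blast
      ultimately show "x \<in> D" using signs_eqD[OF y(2)] CD(2) by blast
    qed
    show "C = D" if "C \<in> ?F" "D \<in> ?F" "?s ` C = ?s ` D" for C D
      using *[OF that] *[OF that(2,1) that(3)[symmetric]] by blast
  qed
  ultimately show ?thesis by (rule finite_imageD)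
qed

lemma eventually_sgn_add_multiple:
  fixes c d :: real
  shows "\<forall>\<^sub>F t in at_right 0. sgn (c + t * d) = (if c = 0 then sgn d else sgn c)"
proof -
  have lim: "((\<lambda>t. c + t * d) \<longlongrightarrow> c + 0 * d) (at_right 0)" by (intro tendsto_intros)
  have pos: "\<forall>\<^sub>F t in at_right (0::real). t > 0" by (simp add: eventually_at_right_less)
  consider "c = 0" | "c > 0" | "c < 0" by linarith
  then show ?thesis
  proof cases
    case 1
    show ?thesis using pos by eventually_elim (use 1 in \<open>simp add: sgn_mult\<close>)
  next
    case 2
    then have "\<forall>\<^sub>F t in at_right 0. 0 < c + t * d" using lim by (intro order_tendstoD(1)) auto
    then show ?thesis using 2 by (auto elim: eventually_mono)
  next
    case 3
    then have "\<forall>\<^sub>F t in at_right 0. c + t * d < 0" using lim by (intro order_tendstoD(2)) auto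
    then show ?thesis using 3 by (auto elim: eventually_mono)
  qed
qed

text \<open>Only the functions that vanish at the base point can notice the direction of a short
  step.\<close>

lemma eventually_agree_move:
  assumes "finite A" "A \<subseteq> rat_affine"
    and "\<And>a. a \<in> A \<Longrightarrow> sgn (a x) = sgn (a y) \<and> (a x = 0 \<longrightarrow> a u = a w)"
  shows "\<forall>\<^sub>F t in at_right 0. agree A (move x t u) (move y t w)"
  unfolding agree_def
proof (intro eventually_ball_finite ballI)
  fix a assume a: "a \<in> A"
  then have af: "a \<in> rat_affine" using assms(2) by auto
  show "\<forall>\<^sub>F t in at_right 0. sgn (a (move x t u)) = sgn (a (move y t w))"
    using eventually_sgn_add_multiple[of "a x" "a u - a (\<lambda>_. 0)"]
      eventually_sgn_add_multiple[of "a y" "a w - a (\<lambda>_. 0)"]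
  proof eventually_elim
    case (elim t)
    then show ?case using assms(3)[OF a] unfolding rat_affine_move[OF af]
      by (auto simp: sgn_zero_iff split: if_splits)
  qed
qed (use assms(1) in simp)

lemma agree_cone_eq:
  assumes A: "finite A" "A \<subseteq> rat_affine"
    and inv: "\<And>x y. x \<in> X \<Longrightarrow> y \<in> Rn n \<Longrightarrow> agree A x y \<Longrightarrow> y \<in> X"
    and "x \<in> Rn n" "y \<in> Rn n" "agree A x y"
  shows "tangent_cone n X x = tangent_cone n X y"
proof (rule tangent_cone_eqI)
  fix u assume u: "u \<in> Rn n"
  have "\<forall>\<^sub>F t in at_right 0. agree A (move x t u) (move y t u)"
    using assms(6) by (intro eventually_agree_move[OF A]) (simp add: agree_def)
  then show "\<forall>\<^sub>F t in at_right 0. (move x t u \<in> X) = (move y t u \<in> X)"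
  proof eventually_elim
    case (elim t)
    then show ?case using inv[of "move x t u" "move y t u"] inv[of "move y t u" "move x t u"]
      agree_sym[OF elim] assms(4,5) u by auto
  qed
qed

text \<open>
  A function in \<open>A\<close> that vanishes at \<open>x\<close> vanishes at \<open>y\<close>, so it is constant in the direction
  \<open>y - x\<close>; the other functions in \<open>A\<close> have constant sign near \<open>x\<close>.
\<close>

lemma agree_diff_lin_cone:
  assumes A: "finite A" "A \<subseteq> rat_affine"
    and inv: "\<And>x y. x \<in> X \<Longrightarrow> y \<in> Rn n \<Longrightarrow> agree A x y \<Longrightarrow> y \<in> X"
    and x: "x \<in> Rn n" and y: "y \<in> Rn n" and xy: "agree A x y"
  shows "(\<lambda>i. y i - x i) \<in> lin n (tangent_cone n X x)"
proof -
  let ?v = "\<lambda>i. y i - x i"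
  have "move w \<alpha> ?v \<in> tangent_cone n X x" if w: "w \<in> tangent_cone n X x" for w \<alpha>
  proof -
    have wR: "w \<in> Rn n" using w tangent_cone_Rn by blast
    have "\<forall>\<^sub>F t in at_right 0. agree A (move x t w) (move x t (move w \<alpha> ?v))"
    proof (rule eventually_agree_move[OF A])
      fix a assume a: "a \<in> A"
      then have af: "a \<in> rat_affine" using A(2) by auto
      have "a y = a x + (a ?v - a (\<lambda>_. 0))"
        using rat_affine_move[OF af, of x 1 ?v] by (simp add: move_def)
      moreover have "a y = 0" if "a x = 0" using xy a that by (auto simp: agree_def sgn_zero_iff)
      ultimately have "a (move w \<alpha> ?v) = a w" if "a x = 0"
        unfolding rat_affine_move[OF af] using that by simp
      then show "sgn (a x) = sgn (a x) \<and> (a x = 0 \<longrightarrow> a w = a (move w \<alpha> ?v))" by simp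
    qed
    moreover have "\<forall>\<^sub>F t in at_right 0. move x t w \<in> X" using w by (simp add: tangent_cone_def)
    ultimately have "\<forall>\<^sub>F t in at_right 0. move x t (move w \<alpha> ?v) \<in> X"
      by eventually_elim (use inv x y wR in auto)
    then show ?thesis using wR x y by (simp add: tangent_cone_def)
  qed
  then show ?thesis using x y by (simp add: lin_def)
qed

section \<open>Strata and singular points\<close>

lemma mem_max_ball_iff:
  assumes "n \<ge> 1" "x \<in> Rn n" "r > 0"
  shows "y \<in> max_ball n x r \<longleftrightarrow> y \<in> Rn n \<and> small r (\<lambda>i. y i - x i)"
proof -
  have "max_norm n (\<lambda>i. x i - y i) < r \<longleftrightarrow> (\<forall>i<n. \<bar>x i - y i\<bar> < r)"
    unfolding max_norm_def using assms(1) by (subst Max_less_iff) (auto simp: lessThan_empty_iff)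
  moreover have "small r (\<lambda>i. y i - x i) \<longleftrightarrow> (\<forall>i<n. \<bar>x i - y i\<bar> < r)" if "y \<in> Rn n"
  proof -
    have "\<bar>y i - x i\<bar> < r" if "\<forall>i<n. \<bar>x i - y i\<bar> < r" for i
      using that \<open>y \<in> Rn n\<close> assms(2,3) by (cases "i < n") (auto simp: Rn_iff abs_minus_commute)
    then show ?thesis by (auto simp: small_def abs_minus_commute)
  qed
  ultimately show ?thesis by (auto simp: max_ball_def)
qed

text \<open>For small t the points x + t w and x + t (w + \<alpha> v) both lie in the given ball and
  on one line parallel to v, so a stratum preserves the cone. Conversely a ball on which
  \<open>X\<close> coincides with its cone witnesses the stratum.\<close>

lemma stratum_iff_lin_cone:
  assumes "n \<ge> 1" "x \<in> Rn n" and conic: "conic_on n X x r"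
  shows "stratum n X x v \<longleftrightarrow> v \<in> lin n (tangent_cone n X x)"
proof
  assume "stratum n X x v"
  then obtain r where v: "v \<in> Rn n" and r: "r > 0"
    "max_ball n x r \<inter> lines_through v (X \<inter> max_ball n x r) \<subseteq> X"
    by (auto simp: stratum_def)
  have "move w \<alpha> v \<in> tangent_cone n X x" if w: "w \<in> tangent_cone n X x" for w \<alpha>
  proof -
    have wR: "w \<in> Rn n" using w tangent_cone_Rn by blast
    have "\<forall>\<^sub>F t in at_right 0. move x t w \<in> X" using w by (simp add: tangent_cone_def)
    moreover have "\<forall>\<^sub>F t in at_right 0. small r (\<lambda>i. t * w i)"
      by (rule eventually_small_scale) fact+
    moreover have "\<forall>\<^sub>F t in at_right 0. small r (\<lambda>i. t * move w \<alpha> v i)"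
      using wR v r(1) by (intro eventually_small_scale[of _ n]) auto
    ultimately have "\<forall>\<^sub>F t in at_right 0. move x t (move w \<alpha> v) \<in> X"
    proof eventually_elim
      case (elim t)
      have ball: "move x t u \<in> max_ball n x r" if "u \<in> Rn n" "small r (\<lambda>i. t * u i)" for u
        using that assms r(1) by (simp add: mem_max_ball_iff) (simp add: move_def)
      have "move x t (move w \<alpha> v) \<in> line_at v (move x t w)"
        unfolding line_at_def move_nested by (auto simp: move_def)
      moreover have "move x t w \<in> X \<inter> max_ball n x r" "move x t (move w \<alpha> v) \<in> max_ball n x r"
        using elim ball wR v by auto
      ultimately show ?case using r(2) unfolding lines_through_def by blast
    qed
    then show ?thesis using wR v by (simp add: tangent_cone_def)
  qed
  then show "v \<in> lin n (tangent_cone n X x)" using v by (simp add: lin_def)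
next
  assume v: "v \<in> lin n (tangent_cone n X x)"
  then have vR: "v \<in> Rn n" by (simp add: lin_def)
  have r: "r > 0" using conic by (simp add: conic_on_def)
  have "z \<in> X" if z: "z \<in> max_ball n x r" "z \<in> line_at v y" and y: "y \<in> X" "y \<in> max_ball n x r" for y z
  proof -
    have iff: "u \<in> X \<longleftrightarrow> (\<lambda>i. u i - x i) \<in> tangent_cone n X x" if "u \<in> max_ball n x r" for u
    proof -
      have u: "(\<lambda>i. u i - x i) \<in> Rn n" "small r (\<lambda>i. u i - x i)"
        using that assms r by (simp_all add: mem_max_ball_iff)
      moreover have "move x 1 (\<lambda>i. u i - x i) = u" by (simp add: move_def)
      ultimately show ?thesis using conic unfolding conic_on_def by metis
    qed
    obtain \<alpha> where "z = move y \<alpha> v" using z(2) by (auto simp: line_at_def move_def)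
    then have "(\<lambda>i. z i - x i) = move (\<lambda>i. y i - x i) \<alpha> v" by (auto simp: move_def)
    then show ?thesis using iff[OF z(1)] iff[OF y(2)] y(1) move_lin_iff[OF v] by simp
  qed
  then show "stratum n X x v"
    unfolding stratum_def lines_through_def using vR r by blast
qed

lemma singular_iff:
  assumes "n \<ge> 1" "x \<in> Rn n \<Longrightarrow> \<exists>r. conic_on n X x r"
  shows "singular n X x \<longleftrightarrow> x \<in> Rn n \<and> lin n (tangent_cone n X x) = {\<lambda>_. 0}"
proof (cases "x \<in> Rn n")
  case True
  then obtain r where "conic_on n X x r" using assms(2) by blast
  then have "{v. stratum n X x v} = lin n (tangent_cone n X x)"
    using stratum_iff_lin_cone[OF assms(1) True] by blast
  then show ?thesis using True by (simp add: singular_def)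
qed (simp add: singular_def)

text \<open>Two such points in one cell differ by a lineality direction of the cone at either, hence
  coincide; so they are at most as many as the sign vectors.\<close>

lemma semilinear_finite_singular:
  assumes "semilinear_on (Rn n) X"
  shows "finite {x \<in> Rn n. lin n (tangent_cone n X x) = {\<lambda>_. 0}}" (is "finite ?S")
proof -
  obtain A where A: "X \<subseteq> Rn n" "finite A" "A \<subseteq> rat_affine"
    "\<And>x y. x \<in> X \<Longrightarrow> y \<in> Rn n \<Longrightarrow> agree A x y \<Longrightarrow> y \<in> X"
    by (rule semilinear_onE[OF assms]) (rule that)
  have "inj_on (signs A) ?S"
  proof (rule inj_onI)
    fix x y assume x: "x \<in> ?S" and y: "y \<in> ?S" and xy: "signs A x = signs A y"
    have "(\<lambda>i. y i - x i) \<in> lin n (tangent_cone n X x)"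
      by (rule agree_diff_lin_cone[OF A(2,3,4) _ _ signs_eqD[OF xy]]) (use x y in auto)
    then have "(\<lambda>i. y i - x i) = (\<lambda>_. 0)" using x by simp
    then show "x = y" by (auto simp: fun_eq_iff)
  qed
  with finite_signs[OF A(2)] show ?thesis by (rule finite_imageD)
qed

text \<open>Together with the rationality of singular points, this is all that the converse
  direction takes from definability with the integers.\<close>

locale conic_set =
  fixes n :: nat and X :: "(nat \<Rightarrow> real) set"
  assumes subset_Rn: "X \<subseteq> Rn n"
    and conic: "x \<in> Rn n \<Longrightarrow> \<exists>r. conic_on n X x r"
    and finite_cones: "finite (tangent_cone n X ` Rn n)"
    and semilinear_cone: "x \<in> Rn n \<Longrightarrow> semilinear_on (Rn n) (tangent_cone n X x)"

lemma RZ_definable_conic_set: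
  assumes "RZ_definable n X"
  shows "conic_set n X"
    and "finite {x \<in> Rn n. lin n (tangent_cone n X x) = {\<lambda>_. 0}} \<Longrightarrow> x \<in> Rn n \<Longrightarrow>
      lin n (tangent_cone n X x) = {\<lambda>_. 0} \<Longrightarrow> x i \<in> \<rat>"
proof -
  obtain B L where B: "finite B" "B \<subseteq> rat_affine" and L: "finite L" "L \<subseteq> rat_affine"
    "\<And>f. f \<in> L \<Longrightarrow> f (\<lambda>_. 0) = 0"
    and pattern: "\<And>x y. x \<in> Rn n \<Longrightarrow> y \<in> Rn n \<Longrightarrow> floors x = floors y \<Longrightarrow>
      agree B (fracs x) (fracs y) \<Longrightarrow>
      \<exists>r>0. \<forall>w\<in>Rn n. \<forall>w'\<in>Rn n. small r w \<longrightarrow> small r w' \<longrightarrow> agree L w w' \<longrightarrow>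
        (move x 1 w \<in> X \<longleftrightarrow> move y 1 w' \<in> X)"
    by (rule RZ_definable_local_pattern[OF assms]) (rule that)
  have L_scale: "f (\<lambda>i. t * w i) = t * f w" if "f \<in> L" for f t w
    using rat_affine_move[OF subsetD[OF L(2) that], of "\<lambda>_. 0" t w] L(3)[OF that]
    by (simp add: move_def)
  have agree_scale: "agree L (\<lambda>i. t * w i) (\<lambda>i. t * w' i) \<longleftrightarrow> agree L w w'" if "t > 0" for t w w'
    using that by (simp add: agree_def L_scale sgn_mult)
  have agree_scale': "agree L w (\<lambda>i. t * w i)" if "t > 0" for t w
    using that by (simp add: agree_def L_scale sgn_mult)
  have pos: "\<forall>\<^sub>F t in at_right (0::real). t > 0" by (simp add: eventually_at_right_less)
  have cone_agree: "w' \<in> tangent_cone n X x"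
    if x: "x \<in> Rn n" and w: "w \<in> tangent_cone n X x" "w' \<in> Rn n" "agree L w w'" for x w w'
  proof -
    obtain r where r: "r > 0" "\<forall>w\<in>Rn n. \<forall>w'\<in>Rn n. small r w \<longrightarrow> small r w' \<longrightarrow> agree L w w' \<longrightarrow>
        (move x 1 w \<in> X \<longleftrightarrow> move x 1 w' \<in> X)"
      using pattern[OF x x refl agree_refl] by blast
    have wR: "w \<in> Rn n" using w(1) tangent_cone_Rn by blast
    have "\<forall>\<^sub>F t in at_right 0. move x t w \<in> X" using w(1) by (simp add: tangent_cone_def)
    then have "\<forall>\<^sub>F t in at_right 0. move x t w' \<in> X"
      using eventually_small_scale[OF wR r(1)] eventually_small_scale[OF w(2) r(1)] pos
    proof eventually_elim
      case (elim t)
      then have "move x 1 (\<lambda>i. t * w i) \<in> X \<longleftrightarrow> move x 1 (\<lambda>i. t * w' i) \<in> X"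
        using wR w(2,3) agree_scale by (intro r(2)[rule_format]) auto
      then show ?case using elim(1) by (simp add: move_scale)
    qed
    then show ?thesis using w(2) by (simp add: tangent_cone_def)
  qed
  show "conic_set n X"
  proof
    show "X \<subseteq> Rn n" using assms by (auto simp: definable_def)
    show "\<exists>r. conic_on n X x r" if x: "x \<in> Rn n" for x
    proof -
      obtain r where r: "r > 0" "\<forall>w\<in>Rn n. \<forall>w'\<in>Rn n. small r w \<longrightarrow> small r w' \<longrightarrow> agree L w w' \<longrightarrow>
          (move x 1 w \<in> X \<longleftrightarrow> move x 1 w' \<in> X)"
        using pattern[OF x x refl agree_refl] by blast
      have "move x 1 w \<in> X \<longleftrightarrow> w \<in> tangent_cone n X x" if w: "w \<in> Rn n" "small r w" for w
      proof -
        \<comment> \<open>Positive scaling does not change the signs of the linear functions in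
          \<open>L\<close>, so membership is constant along the part of the ray inside the
          ball.\<close>
        have "\<forall>\<^sub>F t in at_right 0. (move x t w \<in> X) = (move x 1 w \<in> X)"
          using eventually_small_scale[OF w(1) r(1)] pos
        proof eventually_elim
          case (elim t)
          then have "move x 1 w \<in> X \<longleftrightarrow> move x 1 (\<lambda>i. t * w i) \<in> X"
            using w agree_scale' by (intro r(2)[rule_format]) auto
          then show ?case by (simp add: move_scale)
        qed
        from eventually_subst[OF this] show ?thesis using w(1) by (simp add: tangent_cone_def eventually_const_iff)
      qed
      then show ?thesis using r(1) unfolding conic_on_def by blast
    qed
    have "tangent_cone n X ` Rn n \<subseteq> {C. C \<subseteq> Rn n \<and> (\<forall>x\<in>C. \<forall>y\<in>Rn n. agree L x y \<longrightarrow> y \<in> C)}"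
      using cone_agree tangent_cone_Rn by blast
    then show "finite (tangent_cone n X ` Rn n)" using finite_agree_closed[OF L(1)] by (rule finite_subset)
    show "semilinear_on (Rn n) (tangent_cone n X x)" if "x \<in> Rn n" for x
      by (rule semilinear_onI[OF tangent_cone_Rn L(1,2)]) (rule cone_agree[OF that])
  qed
  assume fin: "finite {x \<in> Rn n. lin n (tangent_cone n X x) = {\<lambda>_. 0}}" and x: "x \<in> Rn n"
    and sing: "lin n (tangent_cone n X x) = {\<lambda>_. 0}"
  \<comment> \<open>The added functions keep all fractional parts in [0, 1) on the segment towards
    \<open>q\<close>, so the floors do not change along it.\<close>
  define B' where "B' = B \<union> ((\<lambda>i x. x i) ` {..<n} \<union> (\<lambda>i x. x i - 1) ` {..<n})"
  have "finite B'" using B by (simp add: B'_def)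
  moreover have B': "B' \<subseteq> rat_affine"
    using B(2) rat_affine.coord rat_affine_diff[OF rat_affine.coord rat_affine.const[of 1]]
    unfolding B'_def by auto
  moreover have "fracs x \<in> Rn n" using x by (simp add: Rn_iff)
  ultimately obtain q where q: "q \<in> Rn n" "\<forall>i. q i \<in> \<rat>" "agree B' (fracs x) q"
    using rational_agree by blast
  define w where "w = (\<lambda>i. q i - frac (x i))"
  have z: "move x s w \<in> Rn n \<and> lin n (tangent_cone n X (move x s w)) = {\<lambda>_. 0}"
    if s: "s \<in> {0..1}" for s
  proof -
    let ?p = "move (fracs x) s w"
    have ag: "agree B' (fracs x) ?p"
      unfolding w_def using agree_segment[OF B' q(3)] s by simp
    have zR: "move x s w \<in> Rn n" using x q(1) by (simp add: w_def Rn_iff move_def)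
    have "agree ((\<lambda>i x. x i) ` {..<n}) (fracs x) ?p" "agree ((\<lambda>i x. x i - 1) ` {..<n}) (fracs x) ?p"
      using ag by (simp_all only: B'_def agree_Un)
    then have sgn_p: "\<forall>i\<in>{..<n}. sgn (frac (x i)) = sgn (?p i)"
      "\<forall>i\<in>{..<n}. sgn (frac (x i) - 1) = sgn (?p i - 1)"
      by (simp_all only: agree_def ball_simps)
    have p01: "0 \<le> ?p i \<and> ?p i < 1" for i
    proof (cases "i < n")
      case True
      then have "sgn (frac (x i)) = sgn (?p i)" "sgn (frac (x i) - 1) = sgn (?p i - 1)"
        using sgn_p by blast+
      then show ?thesis
        using frac_ge_0[of "x i"] frac_lt_1[of "x i"] by (auto simp: sgn_if split: if_splits)
    next
      case False
      then show ?thesis using x q(1) by (simp add: Rn_iff move_def w_def)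
    qed
    have eq: "move x s w i = of_int \<lfloor>x i\<rfloor> + ?p i" for i by (simp add: move_def frac_def)
    have fl: "floors (move x s w) = floors x"
    proof
      fix i
      show "\<lfloor>move x s w i\<rfloor> = \<lfloor>x i\<rfloor>" unfolding eq using p01[of i] by (simp add: floor_eq_iff)
    qed
    have fr: "fracs (move x s w) = ?p"
    proof
      fix i
      have "\<lfloor>move x s w i\<rfloor> = \<lfloor>x i\<rfloor>" using fun_cong[OF fl] by simp
      then show "frac (move x s w i) = ?p i" using eq[of i] by (simp add: frac_def)
    qed
    have "agree B (fracs x) (fracs (move x s w))"
      unfolding fr by (rule agree_mono[OF ag]) (simp add: B'_def)
    then obtain r where r: "r > 0" "\<forall>w1\<in>Rn n. \<forall>w2\<in>Rn n. small r w1 \<longrightarrow> small r w2 \<longrightarrow> agree L w1 w2 \<longrightarrow>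
        (move x 1 w1 \<in> X \<longleftrightarrow> move (move x s w) 1 w2 \<in> X)"
      using pattern[OF x zR fl[symmetric]] by blast
    have "tangent_cone n X x = tangent_cone n X (move x s w)"
    proof (rule tangent_cone_eqI)
      fix u assume u: "u \<in> Rn n"
      show "\<forall>\<^sub>F t in at_right 0. (move x t u \<in> X) = (move (move x s w) t u \<in> X)"
        using eventually_small_scale[OF u r(1)]
      proof eventually_elim
        case (elim t)
        then have "move x 1 (\<lambda>i. t * u i) \<in> X \<longleftrightarrow> move (move x s w) 1 (\<lambda>i. t * u i) \<in> X"
          using u by (intro r(2)[rule_format]) auto
        then show ?case by (simp add: move_scale)
      qed
    qed
    then show ?thesis using sing zR by simp
  qed
  \<comment> \<open>The whole segment consists of singular points. As these are finitely many, the
    segment degenerates, so \<open>w\<close> vanishes and the fractional parts of \<open>x\<close>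
    are those of the rational point \<open>q\<close>.\<close>
  then have "(\<lambda>s. move x s w) ` {0..1} \<subseteq> {x \<in> Rn n. lin n (tangent_cone n X x) = {\<lambda>_. 0}}" by blast
  then have "finite ((\<lambda>s. move x s w) ` {0..1})" using fin by (rule finite_subset)
  then have "\<not> inj_on (\<lambda>s. move x s w) {0..1}"
    using finite_imageD infinite_Icc[of "0::real" 1] by fastforce
  then obtain s t where "s \<noteq> t" "move x s w = move x t w" by (auto simp: inj_on_def)
  then have "w i = 0" using fun_cong[of "move x s w" "move x t w" i] unfolding move_def by simp
  then have "frac (x i) = q i" by (simp add: w_def)
  then have "x i = of_int \<lfloor>x i\<rfloor> + q i" by (simp add: frac_def)
  moreover have "of_int \<lfloor>x i\<rfloor> + q i \<in> \<rat>" using q(2) by simp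
  ultimately show "x i \<in> \<rat>" by simp
qed

section \<open>Strata of a given tangent cone\<close>

lemma semilinear_singleton:
  assumes "x \<in> Rn n" "\<And>i. x i \<in> \<rat>"
  shows "semilinear_on (Rn n) {x}"
proof (rule semilinear_onI[of _ _ "(\<lambda>i y. y i - x i) ` {..<n}"])
  show "(\<lambda>i y. y i - x i) ` {..<n} \<subseteq> rat_affine"
    using rat_affine_diff[OF rat_affine.coord rat_affine.const[OF assms(2)]] by auto
  fix x' y assume "x' \<in> {x}" and y: "y \<in> Rn n" and ag: "agree ((\<lambda>i y. y i - x i) ` {..<n}) x' y"
  then have "sgn (x i - x i) = sgn (y i - x i)" if "i < n" for i
    using that by (auto simp: agree_def)
  then have "y i = x i" for i
    using y assms(1) by (cases "i < n") (auto simp: Rn_iff sgn_zero_iff)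
  then show "y \<in> {x}" by (auto simp: fun_eq_iff)
qed (use assms in auto)

text \<open>The product \<alpha> v of two variables is beyond linear elimination. For a conic set it
  suffices to test \<alpha> = 1 and \<alpha> = -1, since the other values follow by scaling.\<close>

lemma lin_tangent_cone_eq:
  "lin n (tangent_cone n X x) = {v \<in> Rn n. \<forall>w\<in>tangent_cone n X x.
    move w 1 v \<in> tangent_cone n X x \<and> move w (-1) v \<in> tangent_cone n X x}"
proof -
  have "move w \<alpha> v \<in> tangent_cone n X x"
    if v: "v \<in> Rn n" "\<forall>w\<in>tangent_cone n X x.
      move w 1 v \<in> tangent_cone n X x \<and> move w (-1) v \<in> tangent_cone n X x"
      and w: "w \<in> tangent_cone n X x" for v w \<alpha>
  proof (cases "\<alpha> = 0")
    case False
    have "move (\<lambda>i. 1 / \<bar>\<alpha>\<bar> * w i) (sgn \<alpha>) v \<in> tangent_cone n X x"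
    proof -
      have "(\<lambda>i. 1 / \<bar>\<alpha>\<bar> * w i) \<in> tangent_cone n X x" using False by (intro tangent_cone_scale[OF w]) simp
      then show ?thesis using v(2) False by (auto simp: sgn_if)
    qed
    from tangent_cone_scale[OF this, of "\<bar>\<alpha>\<bar>"] False
    have "(\<lambda>i. \<bar>\<alpha>\<bar> * move (\<lambda>i. 1 / \<bar>\<alpha>\<bar> * w i) (sgn \<alpha>) v i) \<in> tangent_cone n X x" by simp
    moreover have "(\<lambda>i. \<bar>\<alpha>\<bar> * move (\<lambda>i. 1 / \<bar>\<alpha>\<bar> * w i) (sgn \<alpha>) v i) = move w \<alpha> v"
    proof
      fix i
      have "\<bar>\<alpha>\<bar> * (1 / \<bar>\<alpha>\<bar> * w i + sgn \<alpha> * v i) = w i + (\<bar>\<alpha>\<bar> * sgn \<alpha>) * v i"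
        using False by (simp add: field_simps)
      also have "\<bar>\<alpha>\<bar> * sgn \<alpha> = \<alpha>" by (simp add: sgn_if)
      finally show "\<bar>\<alpha>\<bar> * move (\<lambda>i. 1 / \<bar>\<alpha>\<bar> * w i) (sgn \<alpha>) v i = move w \<alpha> v i"
        by (simp add: move_def)
    qed
    ultimately show ?thesis by simp
  qed (use w in simp)
  then show ?thesis unfolding lin_def by blast
qed

lemma semilinear_lin:
  assumes "semilinear_on (Rn n) (tangent_cone n X x)"
  shows "semilinear_on (Rn n) (lin n (tangent_cone n X x))"
proof -
  let ?C = "tangent_cone n X x"
  \<comment> \<open>Coordinates 0 to n - 1 of \<open>e\<close> hold v, the next n hold w, and
    \<open>N c e\<close> is w + c v. Below, \<open>S\<close> expresses that w refutes v as a
    lineality direction, and \<open>F\<close> that some w does.\<close>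
  define N where "N c e = (\<lambda>i. if i < n then e (n + i) + c * e i else 0)" for c :: real and e :: "nat \<Rightarrow> real"
  have N_affine: "(\<lambda>e. N c e k) \<in> rat_affine" if "c \<in> \<rat>" for c k
  proof (cases "k < n")
    case True
    then show ?thesis
      using rat_affine.add[OF rat_affine.coord[of "n + k"] rat_affine.scale[OF that rat_affine.coord[of k]]]
      by (simp add: N_def)
  next
    case False
    then show ?thesis using rat_affine.const[of 0] by (simp add: N_def)
  qed
  have N_Rn: "N c e \<in> Rn n" for c e by (simp add: N_def Rn_iff)
  have semi: "semilinear_on UNIV {e. N c e \<in> ?C}" if "c \<in> \<rat>" for c
    using semilinear_on_vimage[OF assms N_affine[OF that] N_Rn, of UNIV] by simp
  define S where "S = {e. N 0 e \<in> ?C} - ({e. N 1 e \<in> ?C} \<inter> {e. N (-1) e \<in> ?C})"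
  define F where "F = {e. \<exists>w. (\<lambda>i. if n \<le> i \<and> i < n + n then w i else e i) \<in> S}"
  have "semilinear_on UNIV S"
    unfolding S_def by (intro semilinear_on_Diff semilinear_on_Int semi) auto
  then have F: "semilinear_on UNIV F"
    unfolding F_def by (rule semilinear_on_Ex_block)
  have N_block: "N c (\<lambda>i. if n \<le> i \<and> i < n + n then w i else v i) = move (restr n (\<lambda>i. w (n + i))) c v"
    if "v \<in> Rn n" for c w v
    using that by (auto simp: N_def move_def restr_def Rn_iff)
  have "v \<in> lin n ?C \<longleftrightarrow> v \<notin> F" if v: "v \<in> Rn n" for v
  proof
    assume L: "v \<in> lin n ?C"
    show "v \<notin> F"
    proof
      assume "v \<in> F"
      then obtain w where "(\<lambda>i. if n \<le> i \<and> i < n + n then w i else v i) \<in> S"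
        unfolding F_def by blast
      then have "restr n (\<lambda>i. w (n + i)) \<in> ?C" "\<not> (move (restr n (\<lambda>i. w (n + i))) 1 v \<in> ?C \<and>
          move (restr n (\<lambda>i. w (n + i))) (-1) v \<in> ?C)"
        unfolding S_def by (auto simp: N_block[OF v])
      then show False using L by (auto simp: lin_def)
    qed
  next
    assume nF: "v \<notin> F"
    have "move w 1 v \<in> ?C \<and> move w (-1) v \<in> ?C" if w: "w \<in> ?C" for w
    proof -
      have "w \<in> Rn n" using w tangent_cone_Rn by blast
      then have eq: "restr n (\<lambda>i. w (n + i - n)) = w" by (simp add: restr_id)
      have "(\<lambda>i. if n \<le> i \<and> i < n + n then w (i - n) else v i) \<notin> S"
        using nF unfolding F_def by auto
      then show ?thesis using w eq unfolding S_def by (auto simp: N_block[OF v])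
    qed
    then show "v \<in> lin n ?C" unfolding lin_tangent_cone_eq using v by blast
  qed
  then have "lin n ?C = Rn n \<inter> - F" by (auto simp: lin_def)
  then show ?thesis using semilinear_on_restrict[OF semilinear_on_UNIV_Compl[OF F], of "Rn n"] by simp
qed

lemma rational_lin:
  assumes "semilinear_on (Rn n) (tangent_cone n X x)" "lin n (tangent_cone n X x) \<noteq> {\<lambda>_. 0}"
  obtains v j where "v \<in> lin n (tangent_cone n X x)" "\<And>i. v i \<in> \<rat>" "v j \<noteq> 0"
proof -
  obtain u where u: "u \<in> lin n (tangent_cone n X x)" "u \<noteq> (\<lambda>_. 0)"
    using assms(2) zero_lin by blast
  then obtain j where j: "u j \<noteq> 0" by auto
  obtain A where A: "finite A" "A \<subseteq> rat_affine" "\<And>x' y. x' \<in> lin n (tangent_cone n X x) \<Longrightarrow>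
      y \<in> Rn n \<Longrightarrow> agree A x' y \<Longrightarrow> y \<in> lin n (tangent_cone n X x)"
    by (rule semilinear_onE[OF semilinear_lin[OF assms(1)]]) (rule that)
  have uR: "u \<in> Rn n" using u(1) by (simp add: lin_def)
  \<comment> \<open>Including the j-th coordinate function keeps the j-th coordinate of the rational
    vector nonzero.\<close>
  have "finite (insert (\<lambda>x. x j) A)" "insert (\<lambda>x. x j) A \<subseteq> rat_affine"
    using A(1,2) rat_affine.coord by auto
  from rational_agree[OF this uR] obtain q where q: "q \<in> Rn n" "\<forall>i. q i \<in> \<rat>"
    "agree (insert (\<lambda>x. x j) A) u q" by blast
  have "q j \<noteq> 0" using q(3) j by (auto simp: agree_insert sgn_zero_iff)
  moreover have "q \<in> lin n (tangent_cone n X x)"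
    using A(3)[OF u(1) q(1)] q(3) by (simp add: agree_insert)
  ultimately show ?thesis using that q(2) by blast
qed

text \<open>\<open>u\<close> is a fixed rational vector, so t u is linear in t and both parameters
  can be eliminated.\<close>

lemma semilinear_ray:
  assumes Y: "semilinear_on (Rn n) Y" and Z: "semilinear_on (Rn n) Z"
    and u: "u \<in> Rn n" "\<And>i. u i \<in> \<rat>"
  shows "semilinear_on (Rn n) {x \<in> Rn n. \<exists>t>0. move x (- t) u \<in> Y \<and>
    (\<forall>s. 0 \<le> s \<and> s < t \<longrightarrow> move x (- s) u \<notin> Z)}"
proof -
  define M where "M k e = (\<lambda>i. if i < n then e i + (- u i) * e k else 0)" for k and e :: "nat \<Rightarrow> real"
  have M_affine: "(\<lambda>e. M k e i) \<in> rat_affine" for k i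
  proof (cases "i < n")
    case True
    have "- u i \<in> \<rat>" using u(2) by simp
    from rat_affine.add[OF rat_affine.coord[of i] rat_affine.scale[OF this rat_affine.coord[of k]]]
    show ?thesis using True by (simp add: M_def)
  next
    case False
    then show ?thesis using rat_affine.const[of 0] by (simp add: M_def)
  qed
  have M_Rn: "M k e \<in> Rn n" for k e by (simp add: M_def Rn_iff)
  have semi: "semilinear_on UNIV {e. M k e \<in> W}" if "semilinear_on (Rn n) W" for k W
    using semilinear_on_vimage[OF that M_affine M_Rn, of UNIV] by simp
  \<comment> \<open>Coordinates n and n + 1 hold t and s. The weak inequality 0 \<le> s is written
    as the complement of - s > 0.\<close>
  define P where "P = {e. M (n + 1) e \<in> Z} \<inter> ({e. e n - e (n + 1) > 0} - {e. - 1 * e (n + 1) > (0::real)})"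
  define Q where "Q = {e. M n e \<in> Y} \<inter> {e. e n > 0} - {e. \<exists>s. e(n + 1 := s) \<in> P}"
  have pos: "semilinear_on UNIV {e. f e > 0}" if "f \<in> rat_affine" for f
    using semilinear_on_pos[OF that, of UNIV] by simp
  have "semilinear_on UNIV P"
    unfolding P_def
    by (intro semilinear_on_Int semilinear_on_Diff semi Z pos rat_affine_diff
        rat_affine.coord rat_affine.scale) simp
  then have "semilinear_on UNIV Q"
    unfolding Q_def
    by (intro semilinear_on_Int semilinear_on_Diff semi Y pos rat_affine.coord semilinear_on_Ex)
  then have "semilinear_on (Rn n) (Rn n \<inter> {e. \<exists>t. e(n := t) \<in> Q})"
    by (intro semilinear_on_restrict semilinear_on_Ex)
  moreover have "e(n := t) \<in> Q \<longleftrightarrow> t > 0 \<and> move e (- t) u \<in> Y \<and>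
    (\<forall>s. 0 \<le> s \<and> s < t \<longrightarrow> move e (- s) u \<notin> Z)" if e: "e \<in> Rn n" for e t
  proof -
    have 1: "M n (e(n := t)) = move e (- t) u"
      using e u(1) by (auto simp: M_def move_def Rn_iff)
    have 2: "M (n + 1) ((e(n := t))(n + 1 := s)) = move e (- s) u" for s
      using e u(1) by (auto simp: M_def move_def Rn_iff)
    have "(e(n := t))(n + 1 := s) \<in> P \<longleftrightarrow> move e (- s) u \<in> Z \<and> 0 \<le> s \<and> s < t" for s
      unfolding P_def by (auto simp: 2[unfolded Suc_eq_plus1[symmetric]])
    then show ?thesis unfolding Q_def by (auto simp: 1)
  qed
  ultimately show ?thesis by (simp add: Int_def cong: conj_cong)
qed

text \<open>
  A stratum direction with nonzero \<open>j\<close>-th coordinate makes a set the product of a line and its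
  section at 0.
\<close>

lemma eq_if_section_eq:
  assumes "C \<subseteq> Rn n" "D \<subseteq> Rn n" "v \<in> lin n C" "v \<in> lin n D" "v j \<noteq> 0"
    and "C \<inter> {x. x j = 0} = D \<inter> {x. x j = 0}"
  shows "C = D"
proof -
  have "u \<in> C \<longleftrightarrow> u \<in> D" for u
  proof -
    let ?u = "move u (- u j / v j) v"
    have "?u j = 0" using assms(5) by (simp add: move_def)
    then have "?u \<in> C \<longleftrightarrow> ?u \<in> D" using assms(6) by blast
    then show ?thesis by (simp only: move_lin_iff[OF assms(3)] move_lin_iff[OF assms(4)])
  qed
  then show ?thesis by blast
qed

text \<open>A direction transversal to the hyperplane leaves it at once, so only directions with
  zero j-th coordinate remain.\<close>

lemma tangent_cone_section:
  assumes "y j = 0"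
  shows "tangent_cone n (X \<inter> {x. x j = 0}) y = tangent_cone n X y \<inter> {x. x j = 0}"
proof -
  have "(\<forall>\<^sub>F t in at_right 0. move y t w \<in> X \<inter> {x. x j = 0}) \<longleftrightarrow>
    (\<forall>\<^sub>F t in at_right 0. move y t w \<in> X) \<and> w j = 0" for w
  proof -
    have pos: "\<forall>\<^sub>F t in at_right (0::real). t > 0" by (simp add: eventually_at_right_less)
    have "(\<forall>\<^sub>F t in at_right (0::real). t * w j = 0) \<longleftrightarrow> w j = 0"
    proof
      assume "\<forall>\<^sub>F t in at_right (0::real). t * w j = 0"
      then have "\<forall>\<^sub>F t in at_right (0::real). w j = 0"
        using pos by eventually_elim auto
      then show "w j = 0" by (simp add: eventually_const_iff)
    qed simp
    then show ?thesis using assms by (simp add: eventually_conj_iff move_def)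
  qed
  then show ?thesis by (auto simp: tangent_cone_def)
qed

section \<open>Constancy of the cone along lines, and slices by a coordinate hyperplane\<close>

context conic_set
begin

lemma eventually_tangent_cone:
  assumes "x \<in> Rn n" "v \<in> Rn n"
  shows "\<forall>\<^sub>F h in at_right 0. tangent_cone n X (move x h v) = tangent_cone n (tangent_cone n X x) v"
  using conic[OF assms(1)] eventually_tangent_cone_move assms(2) by blast

text \<open>The cone just after or just before a point of the line is the cone of its cone in
  direction \<open>w\<close> or - w. The hypothesis thus makes the property of having cone
  \<open>C\<close> locally constant on \<open>I\<close>, and connectedness makes it
  constant.\<close>

lemma tangent_cone_constant_on_line:
  assumes "connected I" "p \<in> Rn n" "w \<in> Rn n"
    and step: "\<And>s. s \<in> I \<Longrightarrow>
      (tangent_cone n (tangent_cone n X (move p s w)) w = C \<longleftrightarrow> tangent_cone n X (move p s w) = C) \<and>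
      (tangent_cone n (tangent_cone n X (move p s w)) (\<lambda>i. - w i) = C \<longleftrightarrow>
        tangent_cone n X (move p s w) = C)"
    and "s \<in> I" "s' \<in> I"
  shows "tangent_cone n X (move p s w) = C \<longleftrightarrow> tangent_cone n X (move p s' w) = C"
proof -
  let ?f = "\<lambda>s. tangent_cone n X (move p s w) = C"
  have "\<forall>\<^sub>F b in at a within I. ?f a = ?f b" if a: "a \<in> I" for a
  proof -
    have aR: "move p a w \<in> Rn n" "(\<lambda>i. - w i) \<in> Rn n" using assms(2,3) by auto
    have "\<forall>\<^sub>F h in at_right 0. ?f a = ?f (h + a)"
      using eventually_tangent_cone[OF aR(1) assms(3)]
    proof eventually_elim
      case (elim h)
      then show ?case using step[OF a] by (simp add: move_move add.commute)
    qed
    then have right: "\<forall>\<^sub>F b in at_right a. ?f a = ?f b"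
      by (subst eventually_at_right_to_0) simp
    have "\<forall>\<^sub>F h in at_right 0. ?f a = ?f (a - h)"
      using eventually_tangent_cone[OF aR]
    proof eventually_elim
      case (elim h)
      have "move (move p a w) h (\<lambda>i. - w i) = move p (a - h) w"
        by (simp add: move_def algebra_simps)
      then show ?case using elim step[OF a] by simp
    qed
    then have left: "\<forall>\<^sub>F b in at_left a. ?f a = ?f b"
      by (subst eventually_at_left_to_right, subst eventually_at_right_to_0) simp
    show ?thesis
      using left right by (meson at_le eventually_at_split filter_leD subset_UNIV)
  qed
  then show ?thesis
    using connected_local_const[OF assms(1), of s s' ?f] assms(5,6) by blast
qed

definition lower :: "(nat \<Rightarrow> real) set \<Rightarrow> (nat \<Rightarrow> real) set" where
  "lower C = {x \<in> Rn n. lin n (tangent_cone n X x) \<subset> lin n C}"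

text \<open>By \<open>lin_cone_mono\<close> the lineality space at \<open>y\<close> is contained in
  that of \<open>C\<close>, and outside \<open>lower C\<close> the inclusion is not strict.\<close>

lemma lin_eq_if_not_lower:
  assumes "y \<in> Rn n" "y \<notin> lower C" "tangent_cone n (tangent_cone n X y) w = C"
  shows "lin n (tangent_cone n X y) = lin n C"
  using assms lin_cone_mono[of n "tangent_cone n X y" w] by (auto simp: lower_def)

text \<open>
  The points at which the tangent cone jumps along a stratum direction of \<open>C\<close> lie in \<open>lower C\<close>.
\<close>

lemma tangent_cone_step_iff:
  assumes "x \<in> Rn n" "C = tangent_cone n X x" "v \<in> lin n C" "y \<in> Rn n" "y \<notin> lower C"
  shows "tangent_cone n (tangent_cone n X y) v = C \<longleftrightarrow> tangent_cone n X y = C"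
proof
  assume *: "tangent_cone n (tangent_cone n X y) v = C"
  then have "v \<in> lin n (tangent_cone n X y)"
    using lin_eq_if_not_lower[OF assms(4,5)] assms(3) by simp
  from tangent_cone_cone_lin[OF this] * show "tangent_cone n X y = C" by simp
next
  assume "tangent_cone n X y = C"
  then show "tangent_cone n (tangent_cone n X y) v = C"
    using tangent_cone_cone_lin[of v n X y] assms(3) by simp
qed

lemma semilinear_slice:
  assumes x: "x \<in> Rn n" and C: "C = tangent_cone n X x" and v: "v \<in> lin n C" "v j \<noteq> 0"
    and sec: "semilinear_on (Rn n) (X \<inter> {x. x j = 0})"
    and low: "semilinear_on (Rn n) (lower C)"
  shows "semilinear_on (Rn n) {y \<in> Rn n. tangent_cone n X y = C \<and> y j = 0}"
proof -
  let ?X0 = "X \<inter> {x. x j = 0}"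
  obtain A where A: "?X0 \<subseteq> Rn n" "finite A" "A \<subseteq> rat_affine"
    "\<And>x y. x \<in> ?X0 \<Longrightarrow> y \<in> Rn n \<Longrightarrow> agree A x y \<Longrightarrow> y \<in> ?X0"
    by (rule semilinear_onE[OF sec]) (rule that)
  obtain B where B: "lower C \<subseteq> Rn n" "finite B" "B \<subseteq> rat_affine"
    "\<And>x y. x \<in> lower C \<Longrightarrow> y \<in> Rn n \<Longrightarrow> agree B x y \<Longrightarrow> y \<in> lower C"
    by (rule semilinear_onE[OF low]) (rule that)
  define D where "D = insert (\<lambda>x. x j) (A \<union> B)"
  have D: "finite D" "D \<subseteq> rat_affine" using A(2,3) B(2,3) rat_affine.coord by (auto simp: D_def)
  have CR: "C \<subseteq> Rn n" unfolding C by (rule tangent_cone_Rn)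
  show ?thesis
  proof (rule semilinear_onI[of _ _ D])
    fix p q assume p: "p \<in> {y \<in> Rn n. tangent_cone n X y = C \<and> y j = 0}" and q: "q \<in> Rn n"
      and pq: "agree D p q"
    have pR: "p \<in> Rn n" and p0: "p j = 0" and pC: "tangent_cone n X p = C" using p by auto
    have q0: "q j = 0" using pq p0 by (simp add: D_def agree_insert sgn_zero_iff)
    define w where "w = (\<lambda>i. q i - p i)"
    have wR: "w \<in> Rn n" using pR q by (simp add: w_def)
    have w0: "w j = 0" using p0 q0 by (simp add: w_def)
    define E where "E = C \<inter> {x. x j = 0}"
    have E: "tangent_cone n ?X0 p = E" using tangent_cone_section[of p j, OF p0] pC by (simp add: E_def)
    have agA: "agree A p q" using pq by (simp add: D_def agree_insert agree_Un)
    \<comment> \<open>Within a cell of the section all differences are lineality directions of its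
      cone, so moving along \<open>w\<close> does not affect the section of the cone.\<close>
    have wE: "w \<in> lin n E"
      using agree_diff_lin_cone[OF A(2,3,4) pR q agA] by (simp add: w_def E)
    have seg: "move p s w \<in> Rn n \<and> move p s w \<notin> lower C \<and>
      tangent_cone n X (move p s w) \<inter> {x. x j = 0} = E" if s: "s \<in> {0..1}" for s
    proof -
      have ag: "agree D p (move p s w)"
        unfolding w_def using agree_segment[OF D(2) pq] s by simp
      have mR: "move p s w \<in> Rn n" using pR wR by simp
      have agB: "agree B p (move p s w)" and agA: "agree A p (move p s w)"
        using ag by (simp_all add: D_def agree_insert agree_Un)
      have "p \<notin> lower C" using pC by (simp add: lower_def)
      then have "move p s w \<notin> lower C"
        using B(4)[OF _ pR agree_sym[OF agB]] by blast
      moreover have "tangent_cone n ?X0 (move p s w) = E"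
        using agree_cone_eq[OF A(2,3,4) pR mR agA] E by simp
      moreover have "move p s w j = 0" using p0 w0 by (simp add: move_def)
      ultimately show ?thesis using tangent_cone_section[of "move p s w" j n X] mR by simp
    qed
    \<comment> \<open>The first implication is closedness and the second openness of the property of
      having cone \<open>C\<close>. In both, \<open>v\<close> is a lineality direction of the cones
      compared, so they are equal once their sections are.\<close>
    have step: "tangent_cone n (tangent_cone n X y) u = C \<longleftrightarrow> tangent_cone n X y = C"
      if y: "y \<in> Rn n" "y \<notin> lower C" "tangent_cone n X y \<inter> {x. x j = 0} = E"
        and u: "u \<in> lin n E" "u j = 0" for y u
    proof
      assume *: "tangent_cone n (tangent_cone n X y) u = C"
      have "v \<in> lin n (tangent_cone n X y)"
        using lin_eq_if_not_lower[OF y(1,2) *] v(1) by simp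
      then show "tangent_cone n X y = C"
        using eq_if_section_eq[OF tangent_cone_Rn CR _ v(1,2)] y(3) by (simp add: E_def)
    next
      assume yC: "tangent_cone n X y = C"
      have "tangent_cone n C u \<inter> {x. x j = 0} = tangent_cone n E u"
        unfolding E_def using tangent_cone_section[of u j n C] u(2) by simp
      also have "\<dots> = E" using tangent_cone_cone_lin[of u n ?X0 p] u(1) E by simp
      finally have "tangent_cone n C u = C"
        using eq_if_section_eq[OF tangent_cone_Rn CR _ v(1,2)] lin_cone_mono[of n C u] v(1)
        by (auto simp: E_def)
      then show "tangent_cone n (tangent_cone n X y) u = C" using yC by simp
    qed
    have "tangent_cone n X (move p 0 w) = C \<longleftrightarrow> tangent_cone n X (move p 1 w) = C"
    proof (rule tangent_cone_constant_on_line[of "{0..1}"])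
      fix s :: real assume s: "s \<in> {0..1}"
      show "(tangent_cone n (tangent_cone n X (move p s w)) w = C \<longleftrightarrow> tangent_cone n X (move p s w) = C) \<and>
        (tangent_cone n (tangent_cone n X (move p s w)) (\<lambda>i. - w i) = C \<longleftrightarrow>
          tangent_cone n X (move p s w) = C)"
        using step[of "move p s w" w] step[of "move p s w" "\<lambda>i. - w i"] seg[OF s] wE lin_minus[OF wE] w0
        by simp
    qed (use pR wR in auto)
    moreover have "move p 1 w = q" by (simp add: move_def w_def)
    ultimately show "q \<in> {y \<in> Rn n. tangent_cone n X y = C \<and> y j = 0}" using pC q q0 by simp
  qed (use D in auto)
qed

end

section \<open>Recovering a stratum along rays\<close>

context conic_set
begin

text \<open>Starting points from which moving in direction u enters the set of points with cone
  \<open>C\<close>: either the cone is already \<open>C\<close>, in the slice, or it is smaller in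
  lineality and becomes \<open>C\<close> immediately afterwards.\<close>

definition along :: "(nat \<Rightarrow> real) set \<Rightarrow> (nat \<Rightarrow> real) \<Rightarrow> nat \<Rightarrow> (nat \<Rightarrow> real) set" where
  "along C u j = {y \<in> Rn n. tangent_cone n X y = C \<and> y j = 0} \<union>
    {y \<in> lower C. tangent_cone n (tangent_cone n X y) u = C}"

text \<open>The starting point, at parameter t, is exempt from the condition since it may belong to
  \<open>lower C\<close>; the endpoint \<open>x\<close>, at s = 0, is not.\<close>

definition ray :: "(nat \<Rightarrow> real) set \<Rightarrow> (nat \<Rightarrow> real) \<Rightarrow> nat \<Rightarrow> (nat \<Rightarrow> real) set" where
  "ray C u j = {x \<in> Rn n. \<exists>t>0. move x (- t) u \<in> along C u j \<and>
    (\<forall>s. 0 \<le> s \<and> s < t \<longrightarrow> move x (- s) u \<notin> lower C)}"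

text \<open>Just after the starting point the cone is \<open>C\<close>, and on the rest of the
  segment there is no point of \<open>lower C\<close> at which it could change. The interval is open
  at the starting point, which may itself be lower.\<close>

lemma tangent_cone_ray:
  assumes x: "x \<in> Rn n" and C: "C = tangent_cone n X x" and u: "u \<in> lin n C"
    and y: "y \<in> ray C u j"
  shows "tangent_cone n X y = C"
proof -
  obtain t where t: "t > 0" "move y (- t) u \<in> along C u j"
    "\<forall>s. 0 \<le> s \<and> s < t \<longrightarrow> move y (- s) u \<notin> lower C" and yR: "y \<in> Rn n"
    using y by (auto simp: ray_def)
  have uR: "u \<in> Rn n" using u by (simp add: lin_def)
  let ?p = "move y (- t) u"
  have pR: "?p \<in> Rn n" using yR uR by simp
  have low: "move ?p s u \<notin> lower C" if "0 < s" "s \<le> t" for s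
    using t(3)[rule_format, of "t - s"] that by (simp add: move_move)
  have step: "(tangent_cone n (tangent_cone n X (move ?p s u)) u = C \<longleftrightarrow> tangent_cone n X (move ?p s u) = C) \<and>
      (tangent_cone n (tangent_cone n X (move ?p s u)) (\<lambda>i. - u i) = C \<longleftrightarrow>
        tangent_cone n X (move ?p s u) = C)" if "move ?p s u \<notin> lower C" for s
    using tangent_cone_step_iff[OF x C u, of "move ?p s u"]
      tangent_cone_step_iff[OF x C lin_minus[OF u], of "move ?p s u"] that pR uR by simp
  have "\<exists>s\<in>{0<..t}. tangent_cone n X (move ?p s u) = C"
  proof -
    have "tangent_cone n (tangent_cone n X ?p) u = C"
      using t(2) tangent_cone_cone_lin[of u n X ?p] u by (auto simp: along_def)
    then have "\<forall>\<^sub>F h in at_right 0. tangent_cone n X (move ?p h u) = C"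
      using eventually_tangent_cone[OF pR uR] by simp
    then have "\<forall>\<^sub>F h in at_right 0. tangent_cone n X (move ?p h u) = C \<and> h \<in> {0<..t}"
      using eventually_at_right_real[OF t(1)] by eventually_elim auto
    then show ?thesis using eventually_happens'[OF trivial_limit_at_right_real] by blast
  qed
  then obtain s where s: "s \<in> {0<..t}" "tangent_cone n X (move ?p s u) = C" by blast
  have "tangent_cone n X (move ?p s u) = C \<longleftrightarrow> tangent_cone n X (move ?p t u) = C"
    by (rule tangent_cone_constant_on_line[of "{0<..t}"])
      (use s(1) t(1) pR uR step low in \<open>auto\<close>)
  then show ?thesis using s(2) by (simp add: move_move)
qed

text \<open>Walk back from \<open>x\<close> towards the hyperplane. Either the cone stays
  \<open>C\<close> up to the slice, or the first point where it differs is a point of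
  \<open>lower C\<close> and hence a starting point.\<close>

lemma ray_cover:
  assumes x: "x \<in> Rn n" and C: "C = tangent_cone n X x" and v: "v \<in> lin n C" "v j \<noteq> 0"
    and "x j \<noteq> 0"
  shows "x \<in> ray C v j \<union> ray C (\<lambda>i. - v i) j"
proof -
  \<comment> \<open>The sign is chosen so that the hyperplane is reached at a positive time
    \<open>T\<close> when moving in direction - u.\<close>
  define u where "u = (if x j / v j > 0 then v else (\<lambda>i. - v i))"
  have u: "u \<in> lin n C" using v(1) lin_minus by (simp add: u_def)
  then have uR: "u \<in> Rn n" by (simp add: lin_def)
  define T where "T = x j / u j"
  have T: "T > 0"
  proof (cases "x j / v j > 0")
    case False
    moreover have "x j / v j \<noteq> 0" using assms(5) v(2) by simp
    ultimately have "x j / v j < 0" by linarith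
    then show ?thesis using False by (simp add: T_def u_def)
  qed (simp add: T_def u_def)
  have uj: "u j \<noteq> 0" using v(2) by (auto simp: u_def)
  have mR: "move x s u \<in> Rn n" for s using x uR by simp
  have "x \<in> ray C u j"
  proof (cases "\<forall>s\<in>{0..T}. tangent_cone n X (move x (- s) u) = C")
    case True
    have "move x (- T) u j = 0" using uj by (simp add: move_def T_def)
    then have "move x (- T) u \<in> along C u j" using True T mR by (simp add: along_def)
    moreover have "move x (- s) u \<notin> lower C" if "0 \<le> s \<and> s < T" for s
      using True that by (simp add: lower_def)
    ultimately show ?thesis using x T by (auto simp: ray_def)
  next
    case False
    define N where "N = {s \<in> {0..T}. tangent_cone n X (move x (- s) u) \<noteq> C}"
    define t where "t = Inf N"
    have N: "N \<noteq> {}" "bdd_below N" "\<And>s. s \<in> N \<Longrightarrow> 0 \<le> s" "\<And>s. s \<in> N \<Longrightarrow> s \<le> T"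
      using False by (auto simp: N_def intro!: bdd_belowI[of _ 0])
    have t0: "t \<ge> 0" unfolding t_def using N by (intro cInf_greatest) auto
    have before: "tangent_cone n X (move x (- s) u) = C" if "0 \<le> s" "s < t" for s
    proof -
      have "s \<notin> N" using that(2) N(2) cInf_lower[of s N] by (auto simp: t_def)
      moreover obtain s' where "s' \<in> N" using N(1) by blast
      then have "t \<le> T" using N(2,4) cInf_lower[of s' N] by (force simp: t_def)
      ultimately show ?thesis using that by (auto simp: N_def)
    qed
    let ?y = "move x (- t) u"
    let ?D = "tangent_cone n X ?y"
    \<comment> \<open>The infimum is attained: if the cone at \<open>?y\<close> were
      \<open>C\<close>, it would remain \<open>C\<close> for a further stretch, and no point of
      \<open>N\<close> could come close to \<open>t\<close>.\<close>
    have not_C: "?D \<noteq> C"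
    proof
      assume D: "?D = C"
      have "\<forall>\<^sub>F h in at_right 0. tangent_cone n X (move ?y h (\<lambda>i. - u i)) = C"
        using eventually_tangent_cone[of ?y "\<lambda>i. - u i"] mR uR D
          tangent_cone_cone_lin[of "\<lambda>i. - u i" n X ?y] lin_minus[OF u] by simp
      then obtain b where b: "b > 0"
        "\<And>h. 0 < h \<Longrightarrow> h < b \<Longrightarrow> tangent_cone n X (move ?y h (\<lambda>i. - u i)) = C"
        unfolding eventually_at_right_field by blast
      have after: "tangent_cone n X (move x (- s) u) = C" if "t \<le> s" "s < t + b" for s
      proof (cases "s = t")
        case False
        have "move ?y (s - t) (\<lambda>i. - u i) = move x (- s) u"
          by (simp add: move_def algebra_simps)
        then show ?thesis using b(2)[of "s - t"] that False by simp
      qed (use D in simp)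
      have "t + b \<le> s" if "s \<in> N" for s
      proof (rule ccontr)
        assume "\<not> t + b \<le> s"
        moreover have "t \<le> s" unfolding t_def using N(2) that by (rule cInf_lower[rotated])
        ultimately show False using after[of s] that by (simp add: N_def)
      qed
      then have "t + b \<le> t" unfolding t_def using N(1) by (intro cInf_greatest) (auto simp: t_def)
      then show False using b(1) by simp
    qed
    have "t > 0"
    proof (rule ccontr)
      assume "\<not> t > 0"
      then have "t = 0" using t0 by simp
      then show False using not_C C by simp
    qed
    have "\<forall>\<^sub>F h in at_right 0. tangent_cone n X (move ?y h u) = C"
      using eventually_at_right_real[OF \<open>t > 0\<close>]
    proof eventually_elim
      case (elim h)
      then show ?case using before[of "t - h"] by (simp add: move_move)
    qed
    moreover have "\<forall>\<^sub>F h in at_right 0. tangent_cone n X (move ?y h u) = tangent_cone n ?D u"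
      by (rule eventually_tangent_cone) (use mR uR in auto)
    ultimately have "\<forall>\<^sub>F h in at_right (0::real). tangent_cone n ?D u = C"
      by eventually_elim simp
    then have Du: "tangent_cone n ?D u = C" by (simp add: eventually_const_iff)
    \<comment> \<open>The cone becomes \<open>C\<close> on leaving \<open>?y\<close> in direction u
      without being \<open>C\<close> there, which outside \<open>lower C\<close> is
      impossible.\<close>
    have "?y \<in> lower C"
      using tangent_cone_step_iff[OF x C u mR] Du not_C by blast
    then have "?y \<in> along C u j" using Du by (simp add: along_def)
    moreover have "move x (- s) u \<notin> lower C" if "0 \<le> s \<and> s < t" for s
      using before that by (simp add: lower_def)
    ultimately show ?thesis using x \<open>t > 0\<close> by (auto simp: ray_def)
  qed
  then show ?thesis by (auto simp: u_def split: if_splits)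
qed

lemma semilinear_tangent_cone_eq:
  assumes fin: "finite {x \<in> Rn n. lin n (tangent_cone n X x) = {\<lambda>_. 0}}"
    and rational: "\<And>x i. x \<in> Rn n \<Longrightarrow> lin n (tangent_cone n X x) = {\<lambda>_. 0} \<Longrightarrow> x i \<in> \<rat>"
    and sec: "\<And>j. j < n \<Longrightarrow> semilinear_on (Rn n) (X \<inter> {x. x j = 0})"
    and "C \<in> tangent_cone n X ` Rn n"
  shows "semilinear_on (Rn n) {x \<in> Rn n. tangent_cone n X x = C}"
  using assms(4)
\<comment> \<open>The number of cones with strictly smaller lineality space is used in place of the
  dimension of that space.\<close>
proof (induction "card {D \<in> tangent_cone n X ` Rn n. lin n D \<subset> lin n C}" arbitrary: C rule: less_induct)
  case less
  let ?T = "\<lambda>C. {x \<in> Rn n. tangent_cone n X x = C}"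
  let ?L = "\<lambda>C. {D \<in> tangent_cone n X ` Rn n. lin n D \<subset> lin n C}"
  obtain x where x: "x \<in> Rn n" and C: "C = tangent_cone n X x" using less.prems by blast
  show ?case
  proof (cases "lin n C = {\<lambda>_. 0}")
    case True
    \<comment> \<open>With trivial lineality space these are singular points: finitely many, all
      rational, so each singleton is semilinear.\<close>
    have "semilinear_on (Rn n) (\<Union>x\<in>?T C. {x})"
    proof (rule semilinear_on_UN)
      show "finite (?T C)" by (rule finite_subset[OF _ fin]) (use True in auto)
      show "semilinear_on (Rn n) {y}" if "y \<in> ?T C" for y
        using that True by (intro semilinear_singleton rational) auto
    qed
    then show ?thesis by simp
  next
    case False
    obtain v j where v: "v \<in> lin n C" "\<And>i. v i \<in> \<rat>" "v j \<noteq> 0"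
      using rational_lin[OF semilinear_cone[OF x]] False C by blast
    have vR: "v \<in> Rn n" using v(1) by (simp add: lin_def)
    have "j < n" using v(3) vR by (metis Rn_iff not_less)
    have fin_L: "finite (?L C)" using finite_cones by simp
    have smaller: "semilinear_on (Rn n) (?T D)" if D: "D \<in> ?L C" for D
    proof (rule less.hyps)
      \<comment> \<open>The inclusion is strict because \<open>D\<close> belongs to
        \<open>?L C\<close> but not to \<open>?L D\<close>.\<close>
      have "?L D \<subset> ?L C" using D by auto
      then show "card (?L D) < card (?L C)" using fin_L by (rule psubset_card_mono[rotated])
    qed (use D in auto)
    have "lower C = (\<Union>D\<in>?L C. ?T D)" by (auto simp: lower_def)
    then have low: "semilinear_on (Rn n) (lower C)"
      using semilinear_on_UN[OF fin_L smaller] by simp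
    have slice: "semilinear_on (Rn n) {y \<in> ?T C. y j = 0}"
      using semilinear_slice[OF x C v(1,3) sec[OF \<open>j < n\<close>] low] by simp
    have ray: "semilinear_on (Rn n) (ray C u j)" if u: "u \<in> lin n C" "\<And>i. u i \<in> \<rat>" for u
    proof -
      have "{y \<in> lower C. tangent_cone n (tangent_cone n X y) u = C} =
          (\<Union>D\<in>{D \<in> ?L C. tangent_cone n D u = C}. ?T D)"
        by (auto simp: lower_def)
      moreover have "semilinear_on (Rn n) (\<Union>D\<in>{D \<in> ?L C. tangent_cone n D u = C}. ?T D)"
        by (rule semilinear_on_UN[OF finite_subset[OF _ fin_L]]) (use smaller in auto)
      ultimately have "semilinear_on (Rn n) (along C u j)"
        unfolding along_def using slice by (intro semilinear_on_Un) (simp_all add: conj_assoc)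
      then show ?thesis
        unfolding ray_def using u low by (intro semilinear_ray) (auto simp: lin_def)
    qed
    have eq: "?T C = {y \<in> ?T C. y j = 0} \<union> (ray C v j \<union> ray C (\<lambda>i. - v i) j)"
    proof (intro equalityI subsetI)
      fix y assume "y \<in> ?T C"
      then show "y \<in> {y \<in> ?T C. y j = 0} \<union> (ray C v j \<union> ray C (\<lambda>i. - v i) j)"
        using ray_cover[of y C v j] v(1,3) by blast
    next
      fix y assume "y \<in> {y \<in> ?T C. y j = 0} \<union> (ray C v j \<union> ray C (\<lambda>i. - v i) j)"
      then show "y \<in> ?T C"
        using tangent_cone_ray[OF x C v(1), of y j] tangent_cone_ray[OF x C lin_minus[OF v(1)], of y j]
        by (auto simp: ray_def)
    qed
    show ?thesis
      by (subst eq) (use v(1,2) lin_minus in \<open>intro semilinear_on_Un slice ray; simp\<close>)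
  qed
qed

text \<open>A point belongs to \<open>X\<close> iff its cone contains the null vector, so
  \<open>X\<close> is a finite union of the sets of points with a given cone.\<close>

lemma semilinear_if_finite_singular:
  assumes "finite {x \<in> Rn n. lin n (tangent_cone n X x) = {\<lambda>_. 0}}"
    and "\<And>x i. x \<in> Rn n \<Longrightarrow> lin n (tangent_cone n X x) = {\<lambda>_. 0} \<Longrightarrow> x i \<in> \<rat>"
    and "\<And>j. j < n \<Longrightarrow> semilinear_on (Rn n) (X \<inter> {x. x j = 0})"
  shows "semilinear_on (Rn n) X"
proof -
  have mem: "(\<lambda>_. 0) \<in> tangent_cone n X x \<longleftrightarrow> x \<in> X" if "x \<in> Rn n" for x
    using conic[OF that] mem_cone_zero by blast
  let ?F = "{C \<in> tangent_cone n X ` Rn n. (\<lambda>_. 0) \<in> C}"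
  have "X = (\<Union>C\<in>?F. {x \<in> Rn n. tangent_cone n X x = C})"
    using mem subset_Rn by auto
  moreover have "semilinear_on (Rn n) (\<Union>C\<in>?F. {x \<in> Rn n. tangent_cone n X x = C})"
  proof (rule semilinear_on_UN)
    show "semilinear_on (Rn n) {x \<in> Rn n. tangent_cone n X x = C}" if "C \<in> ?F" for C
      by (rule semilinear_tangent_cone_eq) (use that assms in auto)
  qed (use finite_cones in simp)
  ultimately show ?thesis by simp
qed

end

theorem theorem6p1:
  fixes n :: nat and X :: "(nat \<Rightarrow> real) set"
  assumes "n \<ge> 1"
    and "X \<subseteq> Rn n"
    and "RZ_definable n X"
  shows "R1_definable n X \<longleftrightarrow>
    finite {x. singular n X x} \<and> (\<forall>Y. rational_section n X Y \<longrightarrow> R1_definable n Y)"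
proof -
  interpret conic_set n X by (rule RZ_definable_conic_set[OF assms(3)])
  have singular: "{x. singular n X x} = {x \<in> Rn n. lin n (tangent_cone n X x) = {\<lambda>_. 0}}"
    using singular_iff[OF assms(1) conic] by blast
  show ?thesis
    \<comment> \<open>Both sides of the equivalence are now statements about cells and lineality
      spaces.\<close>
    unfolding singular R1_definable_iff_semilinear
  proof (intro iffI conjI allI impI)
    assume X: "semilinear_on (Rn n) X"
    then show "finite {x \<in> Rn n. lin n (tangent_cone n X x) = {\<lambda>_. 0}}"
      by (rule semilinear_finite_singular)
    fix Y assume "rational_section n X Y"
    then obtain i c where c: "c \<in> \<rat>" and Y: "Y = X \<inter> {x \<in> Rn n. x i = c}"
      by (auto simp: rational_section_def)
    have "semilinear_on (Rn n) {x \<in> Rn n. x i - c = 0}"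
      by (intro semilinear_on_zero rat_affine_diff rat_affine.coord rat_affine.const c)
    then show "semilinear_on (Rn n) Y"
      unfolding Y using X by (intro semilinear_on_Int) simp_all
  next
    assume R: "finite {x \<in> Rn n. lin n (tangent_cone n X x) = {\<lambda>_. 0}} \<and>
      (\<forall>Y. rational_section n X Y \<longrightarrow> semilinear_on (Rn n) Y)"
    show "semilinear_on (Rn n) X"
    proof (rule semilinear_if_finite_singular)
      show "x i \<in> \<rat>" if "x \<in> Rn n" "lin n (tangent_cone n X x) = {\<lambda>_. 0}" for x i
        using RZ_definable_conic_set(2)[OF assms(3)] R that by blast
      show "semilinear_on (Rn n) (X \<inter> {x. x j = 0})" if "j < n" for j
      proof -
        have "X \<inter> {x. x j = 0} = X \<inter> {x \<in> Rn n. x j = 0}" using assms(2) by blast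
        then have "rational_section n X (X \<inter> {x. x j = 0})"
          unfolding rational_section_def using that by (intro exI[of _ j] conjI bexI[of _ 0]) auto
        then show ?thesis using R by blast
      qed
    qed (use R in blast)
  qed
qed

end
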